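(* Let $n$ be a positive integer and let $D_{2n} = \langle r,s \mid r^n = s^2 = (sr)^2 = 1 \rangle$ be the dihedral group of order $2n$. The faithful hull spectra of $D_{2n}$ are exactly the sets of the form $$\Pi_2 \cup \bigcup_{j \in J} \Pi_j,$$ where $J$ ranges over all collections of positive integers whose least common multiple is $n$. The maximal hull spectrum of $D_{2n}$ is $\Pi_2 \cup \Pi_n$.
   Context: For a set $S$ of $m\times m$ complex matrices (or linear operators on a finite-dimensional complex vector space), $\mathrm{Co}(S)$ denotes the set of all (finite) convex combinations of elements of $S$, and the hull spectrum $\mathrm{HS}(S)\subseteq\mathbb{C}$ is the set of all complex numbers that occur as eigenvalues of some element of $\mathrm{Co}(S)$. $\Pi_k$ denotes the convex hull in $\mathbb{C}$ of the $k$th roots of unity. The faithful hull spectra of a group $\mathcal{G}$ are the sets $\mathrm{HS}(\rho(\mathcal{G}))$ for faithful finite-dimensional complex representations $\rho$ of $\mathcal{G}$, where $\rho(\mathcal{G})$ is the image of $\rho$. The maximal hull spectrum of a finite group $\mathcal{G}$ is $\mathrm{HS}(\rho_{\mathrm{reg}}(\mathcal{G}))$, where $\rho_{\mathrm{reg}}$ is the left regular representation of $\mathcal{G}$ on the space of functions $\mathcal{G}\to\mathbb{C}$, $(\rho_{\mathrm{reg}}(g)f)(g')=f(g^{-1}g')$. *)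

theory Defs
  imports
    "HOL-Analysis.Convex"
    "HOL-Algebra.Group"
    "Jordan_Normal_Form.Char_Poly"
begin

section \<open>Groups given by generators and relations\<close>

text \<open>The letter \<open>(True, x)\<close> stands for the generator \<open>x\<close>, and \<open>(False, x)\<close> for its formal inverse.\<close>

type_synonym 'x word = "(bool \<times> 'x) list"

inductive word_eq :: "'x word set \<Rightarrow> 'x word \<Rightarrow> 'x word \<Rightarrow> bool" for R :: "'x word set" where
  refl: "word_eq R u u"
| sym: "word_eq R u v \<Longrightarrow> word_eq R v u"
| trans: "word_eq R u v \<Longrightarrow> word_eq R v w \<Longrightarrow> word_eq R u w"
| cancel: "word_eq R (u @ [(b, x), (\<not> b, x)] @ v) (u @ v)"
| relator: "w \<in> R \<Longrightarrow> word_eq R (u @ w @ v) (u @ v)"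

definition word_rel :: "'x word set \<Rightarrow> ('x word \<times> 'x word) set" where
  "word_rel R = {(u, v). word_eq R u v}"

text \<open>The group presented by the generators in the type \<open>'x\<close> (all of them) and the relators in \<open>R\<close>.\<close>

definition presented_group :: "'x word set \<Rightarrow> 'x word set monoid" where
  "presented_group R =
    \<lparr>carrier = UNIV // word_rel R,
     mult = (\<lambda>A B. \<Union>a\<in>A. \<Union>b\<in>B. word_rel R `` {a @ b}),
     one = word_rel R `` {[]}\<rparr>"

datatype dihedral_gen = Gen_r | Gen_s

definition dihedral_group :: "nat \<Rightarrow> dihedral_gen word set monoid" where
  "dihedral_group n =
    (let r = (True, Gen_r); s = (True, Gen_s)
     in presented_group {replicate n r, [s, s], [s, r, s, r]})"


section \<open>Hull spectra\<close>

text \<open>Convex combinations are taken entrywise; all matrices in \<open>S\<close> are meant to be \<open>m \<times> m\<close>.\<close>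

definition mat_convex_combs :: "nat \<Rightarrow> complex mat set \<Rightarrow> complex mat set" where
  "mat_convex_combs m S =
    {mat m m (\<lambda>(i, j). \<Sum>A\<in>F. complex_of_real (c A) * A $$ (i, j)) | F c.
       finite F \<and> F \<subseteq> S \<and> (\<forall>A\<in>F. 0 \<le> c A) \<and> sum c F = 1}"

definition hull_spectrum :: "nat \<Rightarrow> complex mat set \<Rightarrow> complex set" where
  "hull_spectrum m S = {z. \<exists>A\<in>mat_convex_combs m S. eigenvalue A z}"

definition roots_hull :: "nat \<Rightarrow> complex set" where
  "roots_hull k = convex hull {z. z ^ k = 1}"

definition GL :: "nat \<Rightarrow> complex mat monoid" where
  "GL m = units_of (ring_mat TYPE(complex) m ())"

definition faithful_hull_spectra :: "('g, 'b) monoid_scheme \<Rightarrow> complex set set" where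
  "faithful_hull_spectra G =
    {hull_spectrum m (\<rho> ` carrier G) | m \<rho>. \<rho> \<in> hom G (GL m) \<and> inj_on \<rho> (carrier G)}"


section \<open>The regular representation and the maximal hull spectrum\<close>

text \<open>A function from the group to \<open>\<complex>\<close> is encoded as a function on the whole type that vanishes
  off the carrier. Operators on such functions replace matrices here, which avoids enumerating the
  group.\<close>

definition carrier_funs :: "('g, 'b) monoid_scheme \<Rightarrow> ('g \<Rightarrow> complex) set" where
  "carrier_funs G = {f. \<forall>x. x \<notin> carrier G \<longrightarrow> f x = 0}"

definition regular_rep ::
    "('g, 'b) monoid_scheme \<Rightarrow> 'g \<Rightarrow> ('g \<Rightarrow> complex) \<Rightarrow> ('g \<Rightarrow> complex)" where
  "regular_rep G g f = (\<lambda>x. if x \<in> carrier G then f (inv\<^bsub>G\<^esub> g \<otimes>\<^bsub>G\<^esub> x) else 0)"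

definition op_convex_combs ::
    "(('x \<Rightarrow> complex) \<Rightarrow> ('x \<Rightarrow> complex)) set \<Rightarrow> (('x \<Rightarrow> complex) \<Rightarrow> ('x \<Rightarrow> complex)) set" where
  "op_convex_combs S =
    {(\<lambda>f x. \<Sum>T\<in>F. complex_of_real (c T) * T f x) | F c.
       finite F \<and> F \<subseteq> S \<and> (\<forall>T\<in>F. 0 \<le> c T) \<and> sum c F = 1}"

definition op_hull_spectrum ::
    "('x \<Rightarrow> complex) set \<Rightarrow> (('x \<Rightarrow> complex) \<Rightarrow> ('x \<Rightarrow> complex)) set \<Rightarrow> complex set" where
  "op_hull_spectrum V S =
    {z. \<exists>T\<in>op_convex_combs S. \<exists>f\<in>V. f \<noteq> (\<lambda>x. 0) \<and> T f = (\<lambda>x. z * f x)}"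

definition maximal_hull_spectrum :: "('g, 'b) monoid_scheme \<Rightarrow> complex set" where
  "maximal_hull_spectrum G = op_hull_spectrum (carrier_funs G) (regular_rep G ` carrier G)"

end

theory Submission
  imports Defs "HOL-Algebra.Coset"
begin

text \<open>Let \<open>T\<close> be a faithful representation of \<open>D\<^bsub>2n\<^esub>\<close> and let
  \<open>\<Sum> a k T(r\<^sup>k) + \<Sum> b k T(s r\<^sup>k)\<close> be a convex combination with an eigenvector \<open>f\<close> for \<open>l\<close>.
  Projecting \<open>f\<close> to the eigenspaces of \<open>T r\<close> for \<open>\<mu>\<close> and \<open>cnj \<mu>\<close>, which \<open>T s\<close> interchanges, gives
  \<open>(z - l)(cnj z - l) = w cnj w\<close> with \<open>z = \<Sum> a k \<mu>\<^sup>k\<close> and \<open>w = \<Sum> b k \<mu>\<^sup>k\<close>, which forces \<open>l\<close> into \<open>\<Pi>\<^sub>2\<close>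
  or into \<open>\<Pi>\<^sub>j\<close>, where \<open>j\<close> is the order of \<open>\<mu>\<close>. Conversely, an eigenvector of \<open>T r\<close> whose eigenvalue has
  order \<open>j\<close> yields \<open>\<Pi>\<^sub>j\<close>, and a \<open>-1\<close>-eigenvector of \<open>T s\<close> yields \<open>\<Pi>\<^sub>2\<close>. So the hull spectrum is
  \<open>\<Pi>\<^sub>2\<close> together with the \<open>\<Pi>\<^sub>j\<close> for the orders \<open>j\<close> of the eigenvalues of \<open>T r\<close>, and by faithfulness
  these orders have least common multiple \<open>n\<close>. Every such set of orders (with \<open>1\<close> added) is realised
  by a sum of two-dimensional representations.\<close>

section \<open>Presented groups\<close>

abbreviation word_class :: "'x word set \<Rightarrow> 'x word \<Rightarrow> 'x word set" where
  "word_class R w \<equiv> word_rel R `` {w}"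

lemma equiv_word_rel: "equiv UNIV (word_rel R)"
  unfolding equiv_def refl_on_def sym_def trans_def word_rel_def
  by (blast intro: word_eq.intros)

lemma word_class_eq_iff: "word_class R u = word_class R v \<longleftrightarrow> word_eq R u v"
  using eq_equiv_class_iff[OF equiv_word_rel, of u v R] by (simp add: word_rel_def)

text \<open>\<open>cancel\<close> and \<open>relator\<close> carry arbitrary contexts, which can be
  enlarged; so compatibility with concatenation follows by induction without being a rule of its
  own.\<close>

lemma word_eq_context: "word_eq R u v \<Longrightarrow> word_eq R (p @ u @ q) (p @ v @ q)"
proof (induction rule: word_eq.induct)
  case (cancel u b x v)
  show ?case using word_eq.cancel[of R "p @ u" b x "v @ q"] by simp
next
  case (relator w u v)
  then show ?case using word_eq.relator[of w R "p @ u" "v @ q"] by simp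
qed (blast intro: word_eq.intros)+

lemma word_eq_append:
  assumes "word_eq R u u'" "word_eq R v v'"
  shows "word_eq R (u @ v) (u' @ v')"
  using word_eq_context[OF assms(1), of "[]" v] word_eq_context[OF assms(2), of u' "[]"]
  by (auto intro: word_eq.trans)

lemma carrier_presented_group: "carrier (presented_group R) = range (word_class R)"
  by (auto simp: presented_group_def quotient_def)

lemma one_presented_group: "\<one>\<^bsub>presented_group R\<^esub> = word_class R []"
  by (simp add: presented_group_def)

text \<open>The double union in \<open>presented_group\<close> collapses to one class because
  concatenation respects \<open>word_eq\<close>.\<close>

lemma mult_presented_group:
  "word_class R u \<otimes>\<^bsub>presented_group R\<^esub> word_class R v = word_class R (u @ v)"
proof -
  have "word_class R (a @ b) = word_class R (u @ v)"
    if "a \<in> word_class R u" "b \<in> word_class R v" for a b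
    unfolding word_class_eq_iff using that
    by (intro word_eq.sym[OF word_eq_append]) (simp_all add: word_rel_def)
  moreover have "u \<in> word_class R u" "v \<in> word_class R v"
    by (simp_all add: word_rel_def word_eq.refl)
  ultimately have "(\<Union>a\<in>word_class R u. \<Union>b\<in>word_class R v. word_class R (a @ b)) = word_class R (u @ v)"
    by blast
  then show ?thesis
    by (simp add: presented_group_def)
qed

definition inverse_word :: "'x word \<Rightarrow> 'x word" where
  "inverse_word w = rev (map (\<lambda>(b, x). (\<not> b, x)) w)"

lemma word_eq_inverse_word: "word_eq R (inverse_word w @ w) []"
proof (induction w)
  case Nil
  show ?case by (simp add: inverse_word_def word_eq.refl)
next
  case (Cons l w)
  obtain b x where l: "l = (b, x)" by (cases l)
  \<comment> \<open>The letter \<open>l\<close> and its inverse meet in the middle of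
    \<open>inverse_word (l # w) @ l # w\<close>; cancelling them leaves the case of
    \<open>w\<close>.\<close>
  have "word_eq R (inverse_word w @ [(\<not> b, x), (\<not> \<not> b, x)] @ w) (inverse_word w @ w)"
    by (rule word_eq.cancel)
  then show ?case
    using Cons by (auto simp: inverse_word_def l intro: word_eq.trans)
qed

lemma group_presented_group: "group (presented_group R)"
proof (rule groupI)
  fix A assume "A \<in> carrier (presented_group R)"
  then obtain w where w: "A = word_class R w"
    by (auto simp: carrier_presented_group)
  have "word_class R (inverse_word w) \<otimes>\<^bsub>presented_group R\<^esub> A = \<one>\<^bsub>presented_group R\<^esub>"
    by (simp add: w mult_presented_group one_presented_group word_class_eq_iff word_eq_inverse_word)
  then show "\<exists>B\<in>carrier (presented_group R). B \<otimes>\<^bsub>presented_group R\<^esub> A = \<one>\<^bsub>presented_group R\<^esub>"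
    by (auto simp: carrier_presented_group)
qed (auto simp: carrier_presented_group mult_presented_group one_presented_group)

section \<open>Universal property of a presentation\<close>

primrec word_eval :: "('h, 'm) monoid_scheme \<Rightarrow> ('x \<Rightarrow> 'h) \<Rightarrow> 'x word \<Rightarrow> 'h" where
  "word_eval H \<phi> [] = \<one>\<^bsub>H\<^esub>"
| "word_eval H \<phi> (l # w) =
     (if fst l then \<phi> (snd l) else inv\<^bsub>H\<^esub> \<phi> (snd l)) \<otimes>\<^bsub>H\<^esub> word_eval H \<phi> w"

lemma (in group) word_eval_closed [simp]:
  "(\<And>x. \<phi> x \<in> carrier G) \<Longrightarrow> word_eval G \<phi> w \<in> carrier G"
  by (induction w) auto

lemma (in group) word_eval_append:
  assumes "\<And>x. \<phi> x \<in> carrier G"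
  shows "word_eval G \<phi> (u @ v) = word_eval G \<phi> u \<otimes> word_eval G \<phi> v"
  by (induction u) (auto simp: assms m_assoc)

lemma (in group) word_eval_word_eq:
  assumes \<phi>: "\<And>x. \<phi> x \<in> carrier G" and R: "\<And>w. w \<in> R \<Longrightarrow> word_eval G \<phi> w = \<one>"
    and "word_eq R u v"
  shows "word_eval G \<phi> u = word_eval G \<phi> v"
  using assms(3)
proof (induction rule: word_eq.induct)
  case (cancel u b x v)
  have "word_eval G \<phi> [(b, x), (\<not> b, x)] = \<one>"
    by (auto simp: \<phi>)
  then show ?case
    by (simp only: word_eval_append \<phi>) (simp add: \<phi>)
qed (simp_all add: word_eval_append \<phi> R)

text \<open>Evaluating a chosen representative does not depend on the choice, since cancellations
  and relators leave the value in \<open>G\<close> unchanged. The matrix representations below are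
  obtained in this way.\<close>

lemma (in group) presented_group_hom:
  assumes \<phi>: "\<And>x. \<phi> x \<in> carrier G" and R: "\<And>w. w \<in> R \<Longrightarrow> word_eval G \<phi> w = \<one>"
  obtains \<rho> where "\<rho> \<in> hom (presented_group R) G"
    and "\<forall>w. \<rho> (word_class R w) = word_eval G \<phi> w"
proof
  define \<rho> where "\<rho> A = word_eval G \<phi> (SOME w. w \<in> A)" for A
  have \<rho>: "\<rho> (word_class R w) = word_eval G \<phi> w" for w
  proof -
    have "(SOME v. v \<in> word_class R w) \<in> word_class R w"
      by (rule someI[of _ w]) (simp add: word_rel_def word_eq.refl)
    then have "word_eq R w (SOME v. v \<in> word_class R w)"
      by (simp add: word_rel_def)
    then show ?thesis
      unfolding \<rho>_def using word_eval_word_eq[OF \<phi> R] by metis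
  qed
  then show "\<forall>w. \<rho> (word_class R w) = word_eval G \<phi> w" ..
  show "\<rho> \<in> hom (presented_group R) G"
    by (auto simp: hom_def carrier_presented_group mult_presented_group \<rho> word_eval_append \<phi>)
qed

lemma inv_presented_group_generator:
  "inv\<^bsub>presented_group R\<^esub> word_class R [(True, x)] = word_class R [(False, x)]"
proof -
  interpret group "presented_group R" by (rule group_presented_group)
  have "word_eq R ([] @ [(False, x), (\<not> False, x)] @ []) ([] @ [])"
    by (rule word_eq.cancel)
  then show ?thesis
    by (intro inv_equality)
       (auto simp: carrier_presented_group mult_presented_group one_presented_group word_class_eq_iff)
qed

lemma presented_group_pow:
  "word_class R [l] [^]\<^bsub>presented_group R\<^esub> k = word_class R (replicate k l)"
proof (induction k)
  case (Suc k)
  have "word_class R [l] [^]\<^bsub>presented_group R\<^esub> Suc k = word_class R (replicate k l @ [l])"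
    unfolding nat_pow_Suc Suc mult_presented_group ..
  then show ?case by (simp add: replicate_append_same)
qed (simp add: one_presented_group)

section \<open>The dihedral group\<close>

text \<open>The relations and \<open>normal_form\<close> bound the order by \<open>2 * n\<close>;
  the last two assumptions exclude a collapse, so the models are exactly the dihedral groups of
  order \<open>2 * n\<close>. This interface keeps words out of the representation theory.\<close>

locale dihedral = group G for G (structure) +
  fixes n :: nat and r s :: 'a
  assumes n_pos: "n > 0"
    and r_closed [simp]: "r \<in> carrier G" and s_closed [simp]: "s \<in> carrier G"
    and r_pow_n: "r [^] n = \<one>"
    and s_s: "s \<otimes> s = \<one>"
    and sr_sr: "s \<otimes> r \<otimes> (s \<otimes> r) = \<one>"
    and normal_form: "\<And>g. g \<in> carrier G \<Longrightarrow> \<exists>k. g = r [^] (k::nat) \<or> g = s \<otimes> r [^] k"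
    and r_pow_eq_one: "\<And>k::nat. r [^] k = \<one> \<Longrightarrow> n dvd k"
    and s_r_pow_neq_one: "\<And>k::nat. s \<otimes> r [^] k \<noteq> \<one>"

abbreviation dihedral_relators :: "nat \<Rightarrow> dihedral_gen word set" where
  "dihedral_relators n \<equiv> {replicate n (True, Gen_r), [(True, Gen_s), (True, Gen_s)],
     [(True, Gen_s), (True, Gen_r), (True, Gen_s), (True, Gen_r)]}"

lemma dihedral_group_eq: "dihedral_group n = presented_group (dihedral_relators n)"
  by (simp add: dihedral_group_def Let_def)

abbreviation dihedral_r :: "nat \<Rightarrow> dihedral_gen word set" where
  "dihedral_r n \<equiv> word_class (dihedral_relators n) [(True, Gen_r)]"

abbreviation dihedral_s :: "nat \<Rightarrow> dihedral_gen word set" where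
  "dihedral_s n \<equiv> word_class (dihedral_relators n) [(True, Gen_s)]"

lemma group_dihedral_group: "group (dihedral_group n)"
  by (simp add: dihedral_group_eq group_presented_group)

lemma dihedral_rs_closed [simp]:
  "dihedral_r n \<in> carrier (dihedral_group n)" "dihedral_s n \<in> carrier (dihedral_group n)"
  by (auto simp: dihedral_group_eq carrier_presented_group)

lemma dihedral_r_pow:
  "dihedral_r n [^]\<^bsub>dihedral_group n\<^esub> k = word_class (dihedral_relators n) (replicate k (True, Gen_r))"
  unfolding dihedral_group_eq by (rule presented_group_pow)

lemma dihedral_relations:
  shows "dihedral_r n [^]\<^bsub>dihedral_group n\<^esub> n = \<one>\<^bsub>dihedral_group n\<^esub>"
    and "dihedral_s n \<otimes>\<^bsub>dihedral_group n\<^esub> dihedral_s n = \<one>\<^bsub>dihedral_group n\<^esub>"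
    and "dihedral_s n \<otimes>\<^bsub>dihedral_group n\<^esub> dihedral_r n \<otimes>\<^bsub>dihedral_group n\<^esub>
         (dihedral_s n \<otimes>\<^bsub>dihedral_group n\<^esub> dihedral_r n) = \<one>\<^bsub>dihedral_group n\<^esub>"
proof -
  have rel: "word_class (dihedral_relators n) w = word_class (dihedral_relators n) []"
    if "w \<in> dihedral_relators n" for w
    using word_eq.relator[OF that, of "[]" "[]"] by (simp only: word_class_eq_iff append_Nil append_Nil2)
  show "dihedral_r n [^]\<^bsub>dihedral_group n\<^esub> n = \<one>\<^bsub>dihedral_group n\<^esub>"
    unfolding dihedral_r_pow unfolding dihedral_group_eq one_presented_group by (rule rel) simp
  show "dihedral_s n \<otimes>\<^bsub>dihedral_group n\<^esub> dihedral_s n = \<one>\<^bsub>dihedral_group n\<^esub>"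
    unfolding dihedral_group_eq one_presented_group mult_presented_group by (rule rel) simp
  show "dihedral_s n \<otimes>\<^bsub>dihedral_group n\<^esub> dihedral_r n \<otimes>\<^bsub>dihedral_group n\<^esub>
         (dihedral_s n \<otimes>\<^bsub>dihedral_group n\<^esub> dihedral_r n) = \<one>\<^bsub>dihedral_group n\<^esub>"
    unfolding dihedral_group_eq one_presented_group mult_presented_group by (rule rel) simp
qed

section \<open>Normal forms from the relations\<close>

text \<open>The third relation makes \<open>s \<otimes> r\<close> equal to its own inverse
  \<open>inv r \<otimes> s\<close>. The inverse of \<open>r\<close> is written as a power so that
  only natural exponents occur.\<close>

lemma (in group) r_s_commute:
  assumes "r \<in> carrier G" "s \<in> carrier G" "n > 0" "r [^] (n::nat) = \<one>" "s \<otimes> s = \<one>"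
    and "s \<otimes> r \<otimes> (s \<otimes> r) = \<one>"
  shows "inv r = r [^] (n - 1)" "inv s = s" "r \<otimes> s = s \<otimes> r [^] (n - 1)"
proof -
  have "r [^] (n - 1) \<otimes> r = \<one>"
    using assms nat_pow_Suc[of r "n - 1"] by simp
  then show ir: "inv r = r [^] (n - 1)"
    using assms by (intro inv_equality) auto
  show inv_s: "inv s = s"
    using assms by (intro inv_equality) auto
  have "s \<otimes> r = inv (s \<otimes> r)"
    using assms by (intro inv_equality[symmetric]) auto
  also have "\<dots> = r [^] (n - 1) \<otimes> s"
    using assms ir inv_s by (simp add: inv_mult_group)
  finally have "s \<otimes> r = r [^] (n - 1) \<otimes> s" .
  \<comment> \<open>Multiplying by \<open>r\<close> on the left and by its inverse
    \<open>r [^] (n - 1)\<close> on the right leads to the commutation rule.\<close>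
  then have "r \<otimes> (s \<otimes> r) \<otimes> r [^] (n - 1) = r \<otimes> (r [^] (n - 1) \<otimes> s) \<otimes> r [^] (n - 1)"
    by simp
  moreover have "r \<otimes> r [^] (n - 1) = \<one>"
    using assms ir by (metis r_inv)
  moreover have "r \<otimes> (s \<otimes> r) \<otimes> r [^] (n - 1) = r \<otimes> s \<otimes> (r \<otimes> r [^] (n - 1))"
    using assms by (simp add: m_assoc)
  moreover have "r \<otimes> (r [^] (n - 1) \<otimes> s) \<otimes> r [^] (n - 1) = (r \<otimes> r [^] (n - 1)) \<otimes> (s \<otimes> r [^] (n - 1))"
    using assms by (simp add: m_assoc)
  ultimately show "r \<otimes> s = s \<otimes> r [^] (n - 1)"
    using assms by simp
qed

text \<open>The commutation rule moves every \<open>s\<close> to the front. This is the induction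
  step over words for the normal form, one case for each letter.\<close>

lemma (in group) dihedral_generated:
  fixes n :: nat
  defines "D \<equiv> \<lambda>r s. {g. \<exists>k::nat. g = r [^] k \<or> g = s \<otimes> r [^] k}"
  assumes rs: "r \<in> carrier G" "s \<in> carrier G" "n > 0" "r [^] n = \<one>" "s \<otimes> s = \<one>"
    "s \<otimes> r \<otimes> (s \<otimes> r) = \<one>"
    and g: "g \<in> D r s"
  shows "r \<otimes> g \<in> D r s" "inv r \<otimes> g \<in> D r s" "s \<otimes> g \<in> D r s" "inv s \<otimes> g \<in> D r s"
proof -
  note comm = r_s_commute[OF rs]
  have D_closed: "g \<in> carrier G" if "g \<in> D r s" for g
    using that rs by (auto simp: D_def)
  have rD: "r \<otimes> g \<in> D r s" if "g \<in> D r s" for g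
  proof -
    from that obtain k :: nat where "g = r [^] k \<or> g = s \<otimes> r [^] k"
      by (auto simp: D_def)
    then show ?thesis
    proof
      assume "g = r [^] k"
      then have "r \<otimes> g = r [^] (Suc k)"
        using rs nat_pow_Suc2 by metis
      then show ?thesis unfolding D_def by blast
    next
      assume g: "g = s \<otimes> r [^] k"
      have "r \<otimes> g = r \<otimes> s \<otimes> r [^] k"
        using rs by (simp add: g m_assoc)
      also have "\<dots> = s \<otimes> r [^] (n - 1 + k)"
        using rs by (simp add: comm m_assoc nat_pow_mult)
      finally show ?thesis unfolding D_def by blast
    qed
  qed
  \<comment> \<open>The exponent \<open>m = n - 1\<close> covers multiplication by
    \<open>inv r\<close>.\<close>
  have "r [^] m \<otimes> g \<in> D r s" for m :: nat
  proof (induction m)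
    case 0
    then show ?case using g D_closed by simp
  next
    case (Suc m)
    have "r [^] Suc m \<otimes> g = r \<otimes> (r [^] m \<otimes> g)"
      using rs g D_closed nat_pow_Suc2 m_assoc nat_pow_closed by metis
    then show ?case using rD[OF Suc] by simp
  qed
  then show "r \<otimes> g \<in> D r s" "inv r \<otimes> g \<in> D r s"
    using rD g by (simp_all add: comm)
  have "s \<otimes> (s \<otimes> r [^] k) = r [^] k" for k :: nat
    using rs by (simp add: m_assoc[symmetric])
  then show "s \<otimes> g \<in> D r s" "inv s \<otimes> g \<in> D r s"
    using g unfolding D_def by (auto simp: comm)
qed

lemma dihedral_normal_form:
  assumes "n > 0" "g \<in> carrier (dihedral_group n)"
  shows "\<exists>k::nat. g = dihedral_r n [^]\<^bsub>dihedral_group n\<^esub> k \<or>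
    g = dihedral_s n \<otimes>\<^bsub>dihedral_group n\<^esub> dihedral_r n [^]\<^bsub>dihedral_group n\<^esub> k"
proof -
  interpret group "dihedral_group n" by (rule group_dihedral_group)
  define D where "D = {g. \<exists>k::nat. g = dihedral_r n [^]\<^bsub>dihedral_group n\<^esub> k \<or>
    g = dihedral_s n \<otimes>\<^bsub>dihedral_group n\<^esub> dihedral_r n [^]\<^bsub>dihedral_group n\<^esub> k}"
  note gen = dihedral_generated[OF dihedral_rs_closed assms(1) dihedral_relations, folded D_def]
  have "word_class (dihedral_relators n) w \<in> D" for w
  proof (induction w)
    case Nil
    have "word_class (dihedral_relators n) [] = dihedral_r n [^]\<^bsub>dihedral_group n\<^esub> (0::nat)"
      unfolding dihedral_r_pow by simp
    then show ?case unfolding D_def by blast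
  next
    case (Cons l w)
    obtain b x where l: "l = (b, x)" by (cases l)
    have inv: "word_class (dihedral_relators n) [(False, x)]
        = inv\<^bsub>dihedral_group n\<^esub> word_class (dihedral_relators n) [(True, x)]" for x
      unfolding dihedral_group_eq inv_presented_group_generator ..
    have "word_class (dihedral_relators n) (l # w) = word_class (dihedral_relators n) [l]
        \<otimes>\<^bsub>dihedral_group n\<^esub> word_class (dihedral_relators n) w"
      unfolding dihedral_group_eq mult_presented_group by simp
    moreover have "word_class (dihedral_relators n) [l]
        \<otimes>\<^bsub>dihedral_group n\<^esub> word_class (dihedral_relators n) w \<in> D"
      using gen[OF Cons] unfolding l by (cases b; cases x) (simp_all only: inv)
    ultimately show ?case by simp
  qed
  then show ?thesis
    using assms(2) unfolding dihedral_group_eq carrier_presented_group D_def by auto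
qed

section \<open>Reindexing sums over one period\<close>

text \<open>The term \<open>F n\<close> that enters the sum equals the term \<open>F 0\<close> that
  leaves it.\<close>

lemma sum_cyclic_shift:
  fixes F :: "nat \<Rightarrow> 'a :: ab_group_add"
  assumes "F n = F 0"
  shows "(\<Sum>k<n. F (Suc k)) = (\<Sum>k<n. F k)"
proof -
  have "F 0 + (\<Sum>k<n. F (Suc k)) = (\<Sum>k<n. F k) + F 0"
    using assms sum.lessThan_Suc_shift[of F n] by simp
  then show ?thesis by (simp add: add.commute)
qed

text \<open>The index \<open>n - k\<close> runs through 1 to \<open>n\<close> instead of 0 to
  \<open>n - 1\<close>; the cyclic shift corrects this.\<close>

lemma sum_cyclic_reflect:
  fixes F :: "nat \<Rightarrow> 'a :: ab_group_add"
  assumes "F n = F 0"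
  shows "(\<Sum>k<n. F (n - k)) = (\<Sum>k<n. F k)"
proof -
  have "(\<Sum>k<n. F (n - k)) = (\<Sum>k<n. F (Suc (n - Suc k)))"
    by (intro sum.cong) (auto simp: Suc_diff_Suc)
  also have "\<dots> = (\<Sum>k<n. F (Suc k))"
    by (rule sum.nat_diff_reindex[of "\<lambda>k. F (Suc k)"])
  finally show ?thesis
    using sum_cyclic_shift[of F n] assms by simp
qed

context dihedral
begin

lemma r_pow_mult_n: "r [^] (n * q) = \<one>"
  by (simp add: nat_pow_pow[symmetric] r_pow_n)

lemma r_pow_mod: "r [^] (k mod n) = r [^] (k::nat)"
proof -
  have "r [^] k = r [^] (n * (k div n) + k mod n)"
    by simp
  also have "\<dots> = r [^] (k mod n)"
    by (subst nat_pow_mult[symmetric]) (simp_all add: r_pow_mult_n)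
  finally show ?thesis by simp
qed

lemma r_pow_dvd: "n dvd k \<Longrightarrow> r [^] k = \<one>"
  by (auto simp: r_pow_mult_n)

lemma r_pow_s: "k \<le> n \<Longrightarrow> r [^] k \<otimes> s = s \<otimes> r [^] (n - k)"
proof (induction k)
  case (Suc k)
  have "r [^] Suc k \<otimes> s = r \<otimes> (r [^] k \<otimes> s)"
    using nat_pow_Suc2[OF r_closed, of k] by (simp add: m_assoc)
  also have "\<dots> = r \<otimes> s \<otimes> r [^] (n - k)"
    using Suc by (simp add: m_assoc)
  also have "\<dots> = s \<otimes> r [^] (n - 1 + (n - k))"
    using r_s_commute(3)[OF r_closed s_closed n_pos r_pow_n s_s sr_sr]
    by (simp add: m_assoc nat_pow_mult)
  also have "n - 1 + (n - k) = n + (n - Suc k)"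
    using Suc.prems by simp
  also have "r [^] (n + (n - Suc k)) = r [^] (n - Suc k)"
    using nat_pow_mult[OF r_closed, of n "n - Suc k"] by (simp add: r_pow_n)
  finally show ?case .
qed (simp add: r_pow_n)

lemma r_pow_inj: "inj_on (\<lambda>k::nat. r [^] k) {..<n}"
proof (rule linorder_inj_onI)
  fix k l :: nat assume kl: "k < l" "k \<in> {..<n}" "l \<in> {..<n}"
  show "r [^] k \<noteq> r [^] l"
  proof
    assume "r [^] k = r [^] l"
    also have "\<dots> = r [^] k \<otimes> r [^] (l - k)"
      using kl by (simp add: nat_pow_mult)
    finally have "r [^] (l - k) = \<one>"
      using l_cancel_one'[of "r [^] k" "r [^] (l - k)"] by simp
    from r_pow_eq_one[OF this] kl show False
      by (auto dest: dvd_imp_le)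
  qed
qed auto

lemma r_pow_neq_s_r_pow: "r [^] (k::nat) \<noteq> s \<otimes> r [^] (l::nat)"
proof
  assume eq: "r [^] k = s \<otimes> r [^] l"
  \<comment> \<open>The exponent \<open>n * k - k\<close> plays the role of \<open>- k\<close>, so
    that the assumed equality would make a reflection trivial.\<close>
  have "s \<otimes> r [^] (l + (n * k - k)) = s \<otimes> r [^] l \<otimes> r [^] (n * k - k)"
    by (simp add: nat_pow_mult m_assoc)
  also have "\<dots> = r [^] (k + (n * k - k))"
    by (simp add: eq[symmetric] nat_pow_mult)
  also have "k + (n * k - k) = n * k"
    using n_pos by simp
  finally show False
    using s_r_pow_neq_one by (simp add: r_pow_mult_n)
qed

lemma carrier_eq: "carrier G = (\<lambda>k. r [^] k) ` {..<n} \<union> (\<lambda>k. s \<otimes> r [^] k) ` {..<n}"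
proof
  show "carrier G \<subseteq> (\<lambda>k. r [^] k) ` {..<n} \<union> (\<lambda>k. s \<otimes> r [^] k) ` {..<n}"
  proof
    fix g assume "g \<in> carrier G"
    then obtain k :: nat where "g = r [^] k \<or> g = s \<otimes> r [^] k"
      using normal_form by blast
    then have "g = r [^] (k mod n) \<or> g = s \<otimes> r [^] (k mod n)"
      by (simp add: r_pow_mod)
    moreover have "k mod n \<in> {..<n}" using n_pos by simp
    ultimately show "g \<in> (\<lambda>k. r [^] k) ` {..<n} \<union> (\<lambda>k. s \<otimes> r [^] k) ` {..<n}" by blast
  qed
qed auto

lemma finite_carrier: "finite (carrier G)"
  by (simp add: carrier_eq)

lemma sum_carrier:
  "(\<Sum>g\<in>carrier G. F g) = (\<Sum>k<n. F (r [^] k)) + (\<Sum>k<n. F (s \<otimes> r [^] k))"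
proof -
  have "inj_on (\<lambda>k::nat. s \<otimes> r [^] k) {..<n}"
    using r_pow_inj by (auto simp: inj_on_def)
  moreover have "(\<lambda>k::nat. r [^] k) ` {..<n} \<inter> (\<lambda>k. s \<otimes> r [^] k) ` {..<n} = {}"
    using r_pow_neq_s_r_pow by auto
  ultimately show ?thesis
    unfolding carrier_eq by (subst sum.union_disjoint) (auto simp: sum.reindex r_pow_inj)
qed

end

section \<open>Convex combinations\<close>

text \<open>A convex combination over a set counts each operator once, although several group
  elements may have the same image; the weights of each fibre are added. Quantifying over
  \<open>\<phi>\<close> lets one choice of weights serve all matrix entries or function
  values.\<close>

lemma weights_push_forward:
  fixes d :: "'g \<Rightarrow> real"
  assumes I: "finite I" "\<forall>g\<in>I. 0 \<le> d g" "sum d I = 1"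
  obtains F c where "finite F" "F \<subseteq> h ` I" "\<forall>A\<in>F. 0 \<le> c A" "sum c F = 1"
    "\<forall>\<phi> :: 'b \<Rightarrow> complex. (\<Sum>A\<in>F. complex_of_real (c A) * \<phi> A) = (\<Sum>g\<in>I. complex_of_real (d g) * \<phi> (h g))"
proof
  let ?c = "\<lambda>A. sum d {g \<in> I. h g = A}"
  show "finite (h ` I)" "h ` I \<subseteq> h ` I" "\<forall>A\<in>h ` I. 0 \<le> ?c A"
    using I by (auto intro: sum_nonneg)
  show "sum ?c (h ` I) = 1"
    using sum.image_gen[OF I(1), of d h] I(3) by simp
  show "\<forall>\<phi> :: 'b \<Rightarrow> complex.
      (\<Sum>A\<in>h ` I. complex_of_real (?c A) * \<phi> A) = (\<Sum>g\<in>I. complex_of_real (d g) * \<phi> (h g))"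
  proof
    fix \<phi> :: "'b \<Rightarrow> complex"
    have "(\<Sum>g\<in>I. complex_of_real (d g) * \<phi> (h g))
        = (\<Sum>A\<in>h ` I. \<Sum>g\<in>{g \<in> I. h g = A}. complex_of_real (d g) * \<phi> (h g))"
      by (rule sum.image_gen[OF I(1)])
    also have "\<dots> = (\<Sum>A\<in>h ` I. complex_of_real (?c A) * \<phi> A)"
      unfolding of_real_sum sum_distrib_right by (intro sum.cong HOL.refl) auto
    finally show "(\<Sum>A\<in>h ` I. complex_of_real (?c A) * \<phi> A) = (\<Sum>g\<in>I. complex_of_real (d g) * \<phi> (h g))"
      by simp
  qed
qed

text \<open>One preimage of each element of \<open>F\<close> receives its weight, and all other
  indices receive 0.\<close>

lemma weights_pull_back:
  fixes c :: "'b \<Rightarrow> real"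
  assumes I: "finite I" and F: "F \<subseteq> h ` I" "\<forall>A\<in>F. 0 \<le> c A" "sum c F = 1"
  obtains d where "\<forall>g\<in>I. 0 \<le> d g" "sum d I = 1"
    "\<forall>\<phi> :: 'b \<Rightarrow> complex. (\<Sum>A\<in>F. complex_of_real (c A) * \<phi> A) = (\<Sum>g\<in>I. complex_of_real (d g) * \<phi> (h g))"
proof -
  from F(1) obtain F' where F': "F' \<subseteq> I" "inj_on h F'" "F = h ` F'"
    by (auto simp: subset_image_inj)
  define d where "d g = (if g \<in> F' then c (h g) else 0)" for g
  have sum_d: "(\<Sum>g\<in>I. complex_of_real (d g) * \<phi> (h g)) = (\<Sum>g\<in>F'. complex_of_real (c (h g)) * \<phi> (h g))"
    for \<phi> :: "'b \<Rightarrow> complex"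
    using I F'(1) by (intro sum.mono_neutral_cong_right) (auto simp: d_def)
  show thesis
  proof
    show "\<forall>g\<in>I. 0 \<le> d g"
      using F F' by (auto simp: d_def)
    have "sum d I = (\<Sum>g\<in>F'. c (h g))"
      using I F'(1) by (intro sum.mono_neutral_cong_right) (auto simp: d_def)
    also have "\<dots> = 1"
      using F(3) F' by (simp add: sum.reindex)
    finally show "sum d I = 1" .
    show "\<forall>\<phi> :: 'b \<Rightarrow> complex.
        (\<Sum>A\<in>F. complex_of_real (c A) * \<phi> A) = (\<Sum>g\<in>I. complex_of_real (d g) * \<phi> (h g))"
      unfolding sum_d using F'(2,3) by (simp add: sum.reindex)
  qed
qed

lemma op_convex_combs_image:
  assumes "finite I"
  shows "op_convex_combs (T ` I) =
    {(\<lambda>f x. \<Sum>g\<in>I. complex_of_real (d g) * T g f x) | d. (\<forall>g\<in>I. 0 \<le> d g) \<and> sum d I = 1}"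
    (is "?L = ?R")
proof (intro subset_antisym subsetI)
  fix A assume "A \<in> ?L"
  then obtain F c where F: "F \<subseteq> T ` I" "\<forall>T\<in>F. 0 \<le> c T" "sum c F = 1"
    and A: "A = (\<lambda>f x. \<Sum>T\<in>F. complex_of_real (c T) * T f x)"
    by (auto simp: op_convex_combs_def)
  obtain d where d: "\<forall>g\<in>I. 0 \<le> d g" "sum d I = 1"
    "\<forall>\<phi>. (\<Sum>A\<in>F. complex_of_real (c A) * \<phi> A) = (\<Sum>g\<in>I. complex_of_real (d g) * \<phi> (T g))"
    by (rule weights_pull_back[OF assms F]) (rule that)
  have "A = (\<lambda>f x. \<Sum>g\<in>I. complex_of_real (d g) * T g f x)"
    unfolding A by (intro ext) (rule d(3)[rule_format])
  with d show "A \<in> ?R" by blast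
next
  fix A assume "A \<in> ?R"
  then obtain d where d: "\<forall>g\<in>I. 0 \<le> d g" "sum d I = 1"
    and A: "A = (\<lambda>f x. \<Sum>g\<in>I. complex_of_real (d g) * T g f x)"
    by auto
  obtain F c where F: "finite F" "F \<subseteq> T ` I"
    "\<forall>A\<in>F. 0 \<le> c A" "sum c F = 1"
    "\<forall>\<phi>. (\<Sum>A\<in>F. complex_of_real (c A) * \<phi> A) = (\<Sum>g\<in>I. complex_of_real (d g) * \<phi> (T g))"
    by (rule weights_push_forward[OF assms d, where h = T]) (rule that)
  have "A = (\<lambda>f x. \<Sum>T\<in>F. complex_of_real (c T) * T f x)"
    unfolding A by (intro ext) (rule F(5)[rule_format, symmetric])
  with F show "A \<in> ?L" unfolding op_convex_combs_def by blast
qed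

lemma mat_convex_combs_image:
  assumes "finite I"
  shows "mat_convex_combs m (\<rho> ` I) =
    {mat m m (\<lambda>(i, j). \<Sum>g\<in>I. complex_of_real (d g) * \<rho> g $$ (i, j)) | d. (\<forall>g\<in>I. 0 \<le> d g) \<and> sum d I = 1}"
    (is "?L = ?R")
proof (intro subset_antisym subsetI)
  fix A assume "A \<in> ?L"
  then obtain F c where F: "F \<subseteq> \<rho> ` I" "\<forall>T\<in>F. 0 \<le> c T" "sum c F = 1"
    and A: "A = mat m m (\<lambda>(i, j). \<Sum>A\<in>F. complex_of_real (c A) * A $$ (i, j))"
    by (auto simp: mat_convex_combs_def)
  obtain d where d: "\<forall>g\<in>I. 0 \<le> d g" "sum d I = 1"
    "\<forall>\<phi>. (\<Sum>A\<in>F. complex_of_real (c A) * \<phi> A) = (\<Sum>g\<in>I. complex_of_real (d g) * \<phi> (\<rho> g))"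
    by (rule weights_pull_back[OF assms F]) (rule that)
  have "A = mat m m (\<lambda>(i, j). \<Sum>g\<in>I. complex_of_real (d g) * \<rho> g $$ (i, j))"
    unfolding A by (intro arg_cong[where f = "mat m m"] ext) (simp add: d(3) split: prod.split)
  with d show "A \<in> ?R" by blast
next
  fix A assume "A \<in> ?R"
  then obtain d where d: "\<forall>g\<in>I. 0 \<le> d g" "sum d I = 1"
    and A: "A = mat m m (\<lambda>(i, j). \<Sum>g\<in>I. complex_of_real (d g) * \<rho> g $$ (i, j))"
    by auto
  obtain F c where F: "finite F" "F \<subseteq> \<rho> ` I"
    "\<forall>A\<in>F. 0 \<le> c A" "sum c F = 1"
    "\<forall>\<phi>. (\<Sum>A\<in>F. complex_of_real (c A) * \<phi> A) = (\<Sum>g\<in>I. complex_of_real (d g) * \<phi> (\<rho> g))"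
    by (rule weights_push_forward[OF assms d, where h = \<rho>]) (rule that)
  have "A = mat m m (\<lambda>(i, j). \<Sum>A\<in>F. complex_of_real (c A) * A $$ (i, j))"
    unfolding A by (intro arg_cong[where f = "mat m m"] ext) (simp add: F(5) split: prod.split)
  with F show "A \<in> ?L" unfolding mat_convex_combs_def by blast
qed

section \<open>Hulls of roots of unity\<close>

text \<open>The number \<open>j\<close> is the exact multiplicative order of \<open>z\<close>; the
  divisibility form combines directly with \<open>Lcm\<close>.\<close>

definition primitive_root :: "nat \<Rightarrow> complex \<Rightarrow> bool" where
  "primitive_root j z \<longleftrightarrow> j > 0 \<and> (\<forall>k. z ^ k = 1 \<longleftrightarrow> j dvd k)"

lemma primitive_root_exists:
  assumes "n > 0" "z ^ n = 1"
  obtains j where "primitive_root j z"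
proof
  let ?P = "\<lambda>k. k > 0 \<and> z ^ k = 1"
  define j where "j = (LEAST k. ?P k)"
  have j: "j > 0" "z ^ j = 1"
    using LeastI[of ?P n] assms unfolding j_def by auto
  have "j dvd k" if "z ^ k = 1" for k
  proof (rule ccontr)
    assume "\<not> j dvd k"
    then have "k mod j > 0" by (simp add: mod_greater_zero_iff_not_dvd)
    moreover have "z ^ (j * (k div j) + k mod j) = 1"
      using that by simp
    then have "z ^ (k mod j) = 1"
      unfolding power_add power_mult using j by simp
    ultimately have "j \<le> k mod j"
      unfolding j_def by (intro Least_le) simp
    then show False
      using j(1) mod_less_divisor[of j k] by linarith
  qed
  moreover have "z ^ k = 1" if "j dvd k" for k
    using that j by (auto simp: power_mult)
  ultimately show "primitive_root j z"
    using j by (auto simp: primitive_root_def)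
qed

text \<open>The powers of \<open>z\<close> with exponents below \<open>j\<close> are
  \<open>j\<close> distinct roots of unity, and there are only \<open>j\<close> of them.\<close>

lemma primitive_root_powers:
  assumes "primitive_root j z" "w ^ j = 1"
  obtains k where "w = z ^ k"
proof -
  have j: "j > 0" "z ^ j = 1"
    using assms by (auto simp: primitive_root_def)
  have z: "z \<noteq> 0"
    using j by (auto simp: zero_power)
  have neq: "z ^ a \<noteq> z ^ b" if "a < b" "b < j" for a b
  proof
    assume "z ^ a = z ^ b"
    also have "\<dots> = z ^ a * z ^ (b - a)"
      using that by (simp flip: power_add)
    finally have "j dvd b - a"
      using z assms by (auto simp: primitive_root_def)
    then show False
      using that by (auto dest: dvd_imp_le)
  qed
  then have "inj_on (\<lambda>k. z ^ k) {..<j}"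
    by (intro linorder_inj_onI) auto
  then have "card ((\<lambda>k. z ^ k) ` {..<j}) = card {w :: complex. w ^ j = 1}"
    using j by (simp add: card_image card_roots_unity_eq)
  moreover have "(\<lambda>k. z ^ k) ` {..<j} \<subseteq> {w. w ^ j = 1}"
  proof clarify
    fix k
    have "(z ^ k) ^ j = (z ^ j) ^ k"
      by (simp add: mult.commute flip: power_mult)
    then show "(z ^ k) ^ j = 1" using j by simp
  qed
  ultimately have "(\<lambda>k. z ^ k) ` {..<j} = {w. w ^ j = 1}"
    using j finite_roots_unity[of j] by (intro card_subset_eq) auto
  then show thesis
    using assms(2) that by blast
qed

lemma primitive_root_cis:
  assumes "n > 0"
  shows "primitive_root n (cis (2 * pi / n))"
proof -
  let ?z = "cis (2 * pi / n)"
  have pow: "?z ^ k = cis (2 * pi * k / n)" for k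
    by (simp add: DeMoivre mult_ac)
  have z_n: "?z ^ n = 1"
    using assms by (simp add: pow)
  have "n dvd k" if "?z ^ k = 1" for k
  proof -
    have "?z ^ (n * (k div n) + k mod n) = 1"
      using that by simp
    then have "?z ^ (k mod n) = ?z ^ 0"
      unfolding power_add power_mult z_n by simp
    moreover have "inj_on (\<lambda>k. ?z ^ k) {..<n}"
      unfolding pow using bij_betw_roots_unity[OF assms] by (simp add: bij_betw_def)
    ultimately have "k mod n = 0"
      using assms inj_onD[of "\<lambda>k. ?z ^ k" "{..<n}" "k mod n" 0] by auto
    then show ?thesis by auto
  qed
  then show ?thesis
    using assms z_n by (auto simp: primitive_root_def power_mult)
qed

lemma primitive_root_cnj: "primitive_root j (cnj z) \<longleftrightarrow> primitive_root j z"
  by (simp add: primitive_root_def flip: complex_cnj_power)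

lemma root_of_unity_mult_cnj:
  fixes z :: complex
  assumes "n > 0" "z ^ n = 1"
  shows "z * cnj z = 1"
proof -
  have "norm z ^ n = 1 ^ n"
    using assms by (simp flip: norm_power)
  then have "norm z = 1"
    using assms by (subst (asm) power_eq_iff_eq_base) auto
  then show ?thesis
    by (simp flip: complex_norm_square)
qed

text \<open>Multiplication by a primitive root \<open>\<omega>\<close> permutes the
  \<open>n\<close>-th roots of unity and scales the sum by \<open>cnj \<omega> ^ k\<close>, which
  differs from 1 for \<open>0 < k < n\<close>.\<close>

lemma sum_roots_unity_power:
  assumes "k < n"
  shows "(\<Sum>z | z ^ n = 1. cnj z ^ k) = (if k = 0 then of_nat n else (0 :: complex))"
proof (cases "k = 0")
  case True
  then show ?thesis using assms by (simp add: card_roots_unity_eq)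
next
  case False
  define \<omega> where "\<omega> = cis (2 * pi / n)"
  have \<omega>: "primitive_root n \<omega>"
    unfolding \<omega>_def using assms by (intro primitive_root_cis) simp
  then have \<omega>_n: "\<omega> ^ n = 1" by (auto simp: primitive_root_def)
  then have \<omega>_cnj: "\<omega> * cnj \<omega> = 1"
    using assms by (intro root_of_unity_mult_cnj[of n]) simp_all
  have cnj_\<omega>: "cnj \<omega> ^ n = 1"
    using \<omega>_n by (simp flip: complex_cnj_power)
  have cancel: "\<omega> * (cnj \<omega> * z) = z" "cnj \<omega> * (\<omega> * z) = z" for z
    using \<omega>_cnj by (simp_all add: mult.commute[of "cnj \<omega>"] flip: mult.assoc)
  have "(\<Sum>z | z ^ n = 1. cnj z ^ k) = (\<Sum>z | z ^ n = 1. cnj (\<omega> * z) ^ k)"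
    by (intro sum.reindex_bij_witness[where i = "\<lambda>z. \<omega> * z" and j = "\<lambda>z. cnj \<omega> * z"])
       (simp_all add: cancel \<omega>_n cnj_\<omega> power_mult_distrib[of _ _ n] del: complex_cnj_mult)
  also have "\<dots> = cnj \<omega> ^ k * (\<Sum>z | z ^ n = 1. cnj z ^ k)"
    by (simp add: power_mult_distrib sum_distrib_left)
  finally have "(1 - cnj \<omega> ^ k) * (\<Sum>z | z ^ n = 1. cnj z ^ k) = 0"
    by (simp add: algebra_simps)
  moreover have "cnj \<omega> ^ k \<noteq> 1"
    using \<omega>[folded primitive_root_cnj[of n \<omega>]] False assms
    by (auto simp: primitive_root_def dest: dvd_imp_le)
  ultimately show ?thesis
    using False by simp
qed

section \<open>Convex geometry of the hulls\<close>

lemma roots_hull_mono: "j dvd n \<Longrightarrow> roots_hull j \<subseteq> roots_hull n"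
  unfolding roots_hull_def by (rule hull_mono) (auto simp: power_mult)

lemma roots_hull_2_eq: "roots_hull 2 = convex hull {1, -1}"
proof -
  have "{z :: complex. z ^ 2 = 1} = {1, -1}"
    by (auto simp: power2_eq_1_iff)
  then show ?thesis by (simp add: roots_hull_def)
qed

lemma roots_hull_1_subset: "roots_hull 1 \<subseteq> roots_hull 2"
  by (rule roots_hull_mono) simp

lemma of_real_in_roots_hull_2:
  assumes "\<bar>x\<bar> \<le> 1"
  shows "complex_of_real x \<in> roots_hull 2"
proof -
  have "((1 + x) / 2) *\<^sub>R (1 :: complex) + ((1 - x) / 2) *\<^sub>R (-1) \<in> convex hull {1, -1}"
    using assms by (intro convexD[OF convex_convex_hull])
      (auto simp: hull_inc field_simps)
  moreover have "((1 + x) / 2) *\<^sub>R (1 :: complex) + ((1 - x) / 2) *\<^sub>R (-1) = complex_of_real x"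
    by (simp add: complex_eq_iff field_simps)
  ultimately show ?thesis by (simp add: roots_hull_2_eq)
qed

text \<open>The centroid of the roots is 0.\<close>

lemma zero_in_roots_hull:
  assumes "j \<ge> 2"
  shows "0 \<in> roots_hull j"
proof -
  let ?Z = "{z :: complex. z ^ j = 1}"
  have fin: "finite ?Z" using assms by (simp add: finite_roots_unity)
  have "(\<Sum>z\<in>?Z. (1 / j) *\<^sub>R z) \<in> convex hull ?Z"
    using assms fin
    by (intro convex_sum convex_convex_hull) (auto simp: hull_inc card_roots_unity_eq)
  moreover have "(\<Sum>z\<in>?Z. (1 / j) *\<^sub>R z) = 0"
    using assms by (simp add: sum_roots_unity flip: scaleR_sum_right)
  ultimately show ?thesis by (simp add: roots_hull_def)
qed

text \<open>The missing weight is put on 0, which lies in the hull for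
  \<open>j \<ge> 2\<close>.\<close>

lemma sub_convex_comb_in_roots_hull:
  assumes "j \<ge> 2" "finite I" "\<And>i. i \<in> I \<Longrightarrow> f i \<in> roots_hull j"
    and "\<And>i. i \<in> I \<Longrightarrow> 0 \<le> a i" "sum a I \<le> 1"
  shows "(\<Sum>i\<in>I. complex_of_real (a i) * f i) \<in> roots_hull j"
proof -
  have convex: "convex (roots_hull j)"
    by (simp add: roots_hull_def)
  show ?thesis
  proof (cases "sum a I = 0")
    case True
    then have "\<forall>i\<in>I. a i = 0"
      using assms by (simp add: sum_nonneg_eq_0_iff)
    then show ?thesis using zero_in_roots_hull[OF assms(1)] by simp
  next
    case False
    define t where "t = sum a I"
    have t: "t > 0" "t \<noteq> 0" "t \<le> 1"
      using False assms by (auto simp: t_def less_le sum_nonneg)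
    have "(\<Sum>i\<in>I. (a i / t) *\<^sub>R f i) \<in> roots_hull j"
      using assms t by (intro convex_sum convex) (auto simp: t_def simp flip: sum_divide_distrib)
    then have "t *\<^sub>R (\<Sum>i\<in>I. (a i / t) *\<^sub>R f i) + (1 - t) *\<^sub>R 0 \<in> roots_hull j"
      using t zero_in_roots_hull[OF assms(1)] by (intro convexD[OF convex]) auto
    moreover have "t *\<^sub>R (\<Sum>i\<in>I. (a i / t) *\<^sub>R f i) = (\<Sum>i\<in>I. complex_of_real (a i) * f i)"
      unfolding scaleR_sum_right scaleR_scaleR
    proof (intro sum.cong HOL.refl)
      fix i
      have "t * (a i / t) = a i"
        using t by simp
      then show "(t * (a i / t)) *\<^sub>R f i = complex_of_real (a i) * f i"
        by (simp only: scaleR_conv_of_real)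
    qed
    ultimately show ?thesis by simp
  qed
qed

text \<open>The equation on \<open>l\<close> is the characteristic equation of the matrix with rows \<open>(z, cnj w)\<close>, \<open>(w, cnj z)\<close>.
  A real solution has modulus at most \<open>cmod z + cmod w\<close>; a nonreal solution lies on the vertical
  segment between \<open>z\<close> and \<open>cnj z\<close>.\<close>

lemma characteristic_root_in_roots_hull:
  assumes \<mu>: "primitive_root j \<mu>"
    and a: "\<And>k. k < n \<Longrightarrow> 0 \<le> a k" and b: "\<And>k. k < n \<Longrightarrow> 0 \<le> b k"
    and ab: "(\<Sum>k<n. a k) + (\<Sum>k<n. b k) = 1"
    and z: "z = (\<Sum>k<n. complex_of_real (a k) * \<mu> ^ k)"
    and w: "w = (\<Sum>k<n. complex_of_real (b k) * \<mu> ^ k)"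
    and l: "(z - l) * (cnj z - l) = w * cnj w"
  shows "l \<in> roots_hull 2 \<union> roots_hull j"
proof (cases "Im l = 0")
  case True
  have "cmod \<mu> ^ 2 = 1"
    using \<mu> root_of_unity_mult_cnj[of j \<mu>] complex_norm_square[of \<mu>]
    by (auto simp: primitive_root_def simp flip: of_real_power)
  then have norm_\<mu>: "cmod \<mu> = 1"
    by (simp add: power2_eq_1_iff) (smt (verit) norm_ge_zero)
  have norm: "cmod (\<Sum>k<n. complex_of_real (c k) * \<mu> ^ k) \<le> (\<Sum>k<n. c k)"
    if "\<And>k. k < n \<Longrightarrow> 0 \<le> c k" for c
    using that by (intro order_trans[OF norm_sum] sum_mono) (simp add: norm_mult norm_power norm_\<mu>)
  have l_real: "l = complex_of_real (Re l)"
    using True by (simp add: complex_eq_iff)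
  \<comment> \<open>As \<open>l\<close> is real, the left-hand side is a squared modulus, so
    \<open>l\<close> has distance \<open>cmod w\<close> from \<open>z\<close>.\<close>
  have "(z - l) * cnj (z - l) = w * cnj w"
    using l l_real by (metis complex_cnj_complex_of_real complex_cnj_diff)
  then have "cmod (z - l) ^ 2 = cmod w ^ 2"
    unfolding complex_norm_square[symmetric] using of_real_eq_iff by blast
  then have "cmod (z - l) = cmod w" by simp
  moreover have "cmod l \<le> cmod z + cmod (z - l)"
    using norm_triangle_ineq4[of z "z - l"] by simp
  ultimately have "cmod l \<le> 1"
    using norm[of a, OF a, folded z] norm[of b, OF b, folded w] ab by linarith
  then have "\<bar>Re l\<bar> \<le> 1"
    using abs_Re_le_cmod[of l] by linarith
  then show ?thesis
    using of_real_in_roots_hull_2 l_real by (metis UnI1)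
next
  case False
  define x y p q where "x = Re z" and "y = Im z" and "p = Re l" and "q = Im l"
  have q: "q \<noteq> 0" using False by (simp add: q_def)
  \<comment> \<open>The right-hand side of the equation is real, and the imaginary part of its
    left-hand side is \<open>2 * q * (p - x)\<close>.\<close>
  have "2 * q * (p - x) = 0"
    using arg_cong[OF l, of Im] by (simp add: x_def y_def p_def q_def algebra_simps)
  then have p: "p = x" using q by simp
  have "y\<^sup>2 - q\<^sup>2 = (Re w)\<^sup>2 + (Im w)\<^sup>2"
    using arg_cong[OF l, of Re] p by (simp add: x_def y_def p_def q_def algebra_simps power2_eq_square)
  moreover have "0 \<le> (Re w)\<^sup>2 + (Im w)\<^sup>2" by simp
  ultimately have "q\<^sup>2 \<le> y\<^sup>2" by linarith
  then have q_le: "\<bar>q\<bar> \<le> \<bar>y\<bar>" by (simp add: abs_le_square_iff)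
  then have y: "y \<noteq> 0" using q by auto
  \<comment> \<open>For \<open>j = 1\<close> the number \<open>z\<close> would be real; excluding
    this case puts 0 into the hull.\<close>
  have "j \<noteq> 1"
  proof
    assume "j = 1"
    then have "\<mu> = 1" using \<mu> by (auto simp: primitive_root_def dest: spec[of _ 1])
    then show False using y by (simp add: y_def z)
  qed
  then have j: "j \<ge> 2" using \<mu> by (auto simp: primitive_root_def)
  have b_nonneg: "0 \<le> (\<Sum>k<n. b k)"
    using b by (intro sum_nonneg) simp
  \<comment> \<open>The weights \<open>a\<close> may sum to less than 1, because the rest is carried
    by \<open>b\<close>.\<close>
  have in_hull: "(\<Sum>k<n. complex_of_real (a k) * \<nu> ^ k) \<in> roots_hull j" if "primitive_root j \<nu>" for \<nu>
  proof (rule sub_convex_comb_in_roots_hull[OF j])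
    have "(\<nu> ^ k) ^ j = 1" for k
      using that by (auto simp: primitive_root_def simp flip: power_mult)
    then show "\<nu> ^ k \<in> roots_hull j" for k
      unfolding roots_hull_def by (intro hull_inc) simp
  qed (use a ab b_nonneg in auto)
  have z_in: "z \<in> roots_hull j"
    unfolding z by (rule in_hull) fact
  have cnj_z_in: "cnj z \<in> roots_hull j"
    using in_hull[of "cnj \<mu>"] \<mu> by (simp add: z primitive_root_cnj)
  \<comment> \<open>The parameter \<open>t\<close> locates \<open>l\<close> on the vertical segment:
    1 stands for \<open>z\<close> and -1 for \<open>cnj z\<close>.\<close>
  define t where "t = q / y"
  have "\<bar>t\<bar> \<le> 1"
    using q_le y by (simp add: t_def)
  then have t: "0 \<le> (1 + t) / 2" "0 \<le> (1 - t) / 2" "(1 + t) / 2 + (1 - t) / 2 = 1"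
    by (auto simp: field_simps)
  have "convex (roots_hull j)"
    by (simp add: roots_hull_def)
  from convexD[OF this z_in cnj_z_in t]
  have "((1 + t) / 2) *\<^sub>R z + ((1 - t) / 2) *\<^sub>R cnj z \<in> roots_hull j" .
  moreover have "((1 + t) / 2) *\<^sub>R z + ((1 - t) / 2) *\<^sub>R cnj z = l"
  proof (rule complex_eqI)
    show "Re (((1 + t) / 2) *\<^sub>R z + ((1 - t) / 2) *\<^sub>R cnj z) = Re l"
      using p by (simp add: x_def p_def field_simps)
    have "Im (((1 + t) / 2) *\<^sub>R z + ((1 - t) / 2) *\<^sub>R cnj z) = t * y"
      by (simp add: y_def field_simps)
    then show "Im (((1 + t) / 2) *\<^sub>R z + ((1 - t) / 2) *\<^sub>R cnj z) = Im l"
      using y by (simp add: t_def q_def)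
  qed
  ultimately show ?thesis by simp
qed

section \<open>Hull spectra of faithful representations\<close>

text \<open>Vectors are functions, so that matrix representations and the regular representation are
  instances of one locale. The laws are required only on the subspace \<open>V\<close>, as
  \<open>T g\<close> is defined on all functions.\<close>

locale dihedral_rep = dihedral +
  fixes V :: "('x \<Rightarrow> complex) set" and T :: "'a \<Rightarrow> ('x \<Rightarrow> complex) \<Rightarrow> 'x \<Rightarrow> complex"
  assumes V_zero: "(\<lambda>x. 0) \<in> V"
    and V_add_mult: "\<And>f h c. f \<in> V \<Longrightarrow> h \<in> V \<Longrightarrow> (\<lambda>x. f x + c * h x) \<in> V"
    and T_closed: "\<And>g f. g \<in> carrier G \<Longrightarrow> f \<in> V \<Longrightarrow> T g f \<in> V"
    and T_add_mult: "\<And>g f h c. g \<in> carrier G \<Longrightarrow> f \<in> V \<Longrightarrow> h \<in> V \<Longrightarrow>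
      T g (\<lambda>x. f x + c * h x) = (\<lambda>x. T g f x + c * T g h x)"
    and T_one: "\<And>f. f \<in> V \<Longrightarrow> T \<one> f = f"
    and T_mult: "\<And>g h f. g \<in> carrier G \<Longrightarrow> h \<in> carrier G \<Longrightarrow> f \<in> V \<Longrightarrow> T (g \<otimes> h) f = T g (T h f)"
    and T_faithful: "\<And>g. g \<in> carrier G \<Longrightarrow> (\<And>f. f \<in> V \<Longrightarrow> T g f = f) \<Longrightarrow> g = \<one>"
begin

section \<open>Linearity and the eigenprojections of \<open>T r\<close>\<close>

lemma T_zero:
  assumes "g \<in> carrier G"
  shows "T g (\<lambda>x. 0) = (\<lambda>x. 0)"
  using T_add_mult[OF assms V_zero V_zero, of "-1"] by simp

lemma V_sum: "finite I \<Longrightarrow> (\<And>i. i \<in> I \<Longrightarrow> f i \<in> V) \<Longrightarrow> (\<lambda>x. \<Sum>i\<in>I. c i * f i x) \<in> V"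
proof (induction I rule: finite_induct)
  case (insert i I)
  then show ?case
    using V_add_mult[of "\<lambda>x. \<Sum>i\<in>I. c i * f i x" "f i" "c i"] by (simp add: add.commute)
qed (simp add: V_zero)

lemma V_mult: "f \<in> V \<Longrightarrow> (\<lambda>x. c * f x) \<in> V"
  using V_add_mult[OF V_zero, of f c] by simp

lemma T_sum:
  assumes "g \<in> carrier G"
  shows "finite I \<Longrightarrow> (\<And>i. i \<in> I \<Longrightarrow> f i \<in> V) \<Longrightarrow>
    T g (\<lambda>x. \<Sum>i\<in>I. c i * f i x) = (\<lambda>x. \<Sum>i\<in>I. c i * T g (f i) x)"
proof (induction I rule: finite_induct)
  case (insert i I)
  then show ?case
    using T_add_mult[OF assms, of "\<lambda>x. \<Sum>i\<in>I. c i * f i x" "f i" "c i"] V_sum[of I f c]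
    by (simp add: add.commute)
qed (simp add: T_zero assms)

lemma T_mult_scalar: "g \<in> carrier G \<Longrightarrow> f \<in> V \<Longrightarrow> T g (\<lambda>x. c * f x) = (\<lambda>x. c * T g f x)"
  using T_sum[of g "{()}" "\<lambda>_. f" "\<lambda>_. c"] by simp

lemma T_r_pow_eigenvector:
  assumes "f \<in> V" "T r f = (\<lambda>x. \<mu> * f x)"
  shows "T (r [^] (k::nat)) f = (\<lambda>x. \<mu> ^ k * f x)"
proof (induction k)
  case (Suc k)
  have "T (r [^] Suc k) f = T (r [^] k) (T r f)"
    using assms(1) by (simp add: T_mult)
  then show ?case
    using assms Suc by (simp add: T_mult_scalar mult_ac)
qed (use assms T_one in simp)

text \<open>Up to the factor \<open>n\<close>, the projection onto the eigenspace of \<open>T r\<close> for the \<open>n\<close>-th root of unity \<open>\<mu>\<close>.\<close>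

definition proj :: "complex \<Rightarrow> ('x \<Rightarrow> complex) \<Rightarrow> 'x \<Rightarrow> complex" where
  "proj \<mu> f = (\<lambda>x. \<Sum>k<n. cnj \<mu> ^ k * T (r [^] k) f x)"

lemma proj_closed: "f \<in> V \<Longrightarrow> proj \<mu> f \<in> V"
  unfolding proj_def by (intro V_sum T_closed) auto

lemma proj_sum:
  assumes "finite I" "\<And>i. i \<in> I \<Longrightarrow> f i \<in> V"
  shows "proj \<mu> (\<lambda>x. \<Sum>i\<in>I. c i * f i x) = (\<lambda>x. \<Sum>i\<in>I. c i * proj \<mu> (f i) x)"
proof
  fix x
  have "proj \<mu> (\<lambda>x. \<Sum>i\<in>I. c i * f i x) x
      = (\<Sum>k<n. \<Sum>i\<in>I. c i * (cnj \<mu> ^ k * T (r [^] k) (f i) x))"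
    unfolding proj_def
    by (intro sum.cong HOL.refl) (subst T_sum[OF _ assms], auto simp: sum_distrib_left intro!: sum.cong)
  also have "\<dots> = (\<Sum>i\<in>I. c i * proj \<mu> (f i) x)"
    unfolding proj_def sum_distrib_left by (rule sum.swap)
  finally show "proj \<mu> (\<lambda>x. \<Sum>i\<in>I. c i * f i x) x = (\<Sum>i\<in>I. c i * proj \<mu> (f i) x)" .
qed

lemma proj_mult: "f \<in> V \<Longrightarrow> proj \<mu> (\<lambda>x. c * f x) = (\<lambda>x. c * proj \<mu> f x)"
  using proj_sum[of "{()}" "\<lambda>_. f" \<mu> "\<lambda>_. c"] by simp

text \<open>Applying \<open>T r\<close> shifts the summation index, and as \<open>cnj \<mu>\<close>
  is the inverse of \<open>\<mu>\<close>, the shift costs a factor \<open>\<mu>\<close>.\<close>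

lemma T_r_proj:
  assumes "f \<in> V" "\<mu> ^ n = 1"
  shows "T r (proj \<mu> f) = (\<lambda>x. \<mu> * proj \<mu> f x)"
proof
  fix x
  let ?F = "\<lambda>k. cnj \<mu> ^ k * T (r [^] k) f x"
  have \<mu>: "\<mu> * cnj \<mu> = 1"
    using root_of_unity_mult_cnj[OF n_pos assms(2)] .
  have cnj_\<mu>: "cnj \<mu> ^ n = 1"
    using assms(2) by (simp flip: complex_cnj_power)
  have cancel: "cnj \<mu> ^ k * y = \<mu> * (cnj \<mu> ^ Suc k * y)" for k y
  proof -
    have "\<mu> * (cnj \<mu> ^ Suc k * y) = (\<mu> * cnj \<mu>) * (cnj \<mu> ^ k * y)"
      by (simp only: power_Suc mult.assoc)
    then show ?thesis by (simp add: \<mu>)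
  qed
  have T_Suc: "T r (T (r [^] k) f) = T (r [^] Suc k) f" for k :: nat
    using assms(1) nat_pow_Suc2[OF r_closed, of k] by (simp add: T_mult del: nat_pow_Suc)
  have "T r (proj \<mu> f) x = (\<Sum>k<n. cnj \<mu> ^ k * T (r [^] Suc k) f x)"
    unfolding proj_def using assms(1) by (subst T_sum) (auto simp: T_closed T_Suc simp del: nat_pow_Suc)
  also have "\<dots> = \<mu> * (\<Sum>k<n. ?F (Suc k))"
    unfolding sum_distrib_left
    by (intro sum.cong HOL.refl) (rule cancel)
  also have "(\<Sum>k<n. ?F (Suc k)) = (\<Sum>k<n. ?F k)"
    by (rule sum_cyclic_shift) (simp add: cnj_\<mu> r_pow_n)
  finally show "T r (proj \<mu> f) x = \<mu> * proj \<mu> f x"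
    by (simp add: proj_def)
qed

text \<open>The projection commutes with powers of \<open>T r\<close>, which act on its values as
  powers of \<open>\<mu>\<close>.\<close>

lemma proj_T_r_pow:
  assumes "f \<in> V" "\<mu> ^ n = 1"
  shows "proj \<mu> (T (r [^] (k::nat)) f) = (\<lambda>x. \<mu> ^ k * proj \<mu> f x)"
proof -
  have comm: "T (r [^] l) (T (r [^] k) f) = T (r [^] k) (T (r [^] l) f)" for l :: nat
    using assms(1) by (simp add: nat_pow_mult add.commute flip: T_mult)
  have "proj \<mu> (T (r [^] k) f) = T (r [^] k) (proj \<mu> f)"
    unfolding proj_def using assms(1) by (subst T_sum) (auto simp: T_closed comm)
  also have "\<dots> = (\<lambda>x. \<mu> ^ k * proj \<mu> f x)"
    using assms by (intro T_r_pow_eigenvector proj_closed T_r_proj)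
  finally show ?thesis .
qed

text \<open>Moving \<open>s\<close> past \<open>r [^] k\<close> replaces \<open>k\<close> by
  \<open>n - k\<close>, and \<open>cnj \<mu> ^ k = \<mu> ^ (n - k)\<close>; reflecting the sum
  exhibits the projection for the conjugate eigenvalue.\<close>

lemma proj_T_s:
  assumes "f \<in> V" "\<mu> ^ n = 1"
  shows "proj \<mu> (T s f) = T s (proj (cnj \<mu>) f)"
proof
  fix x
  let ?F = "\<lambda>k. \<mu> ^ k * T s (T (r [^] k) f) x"
  have \<mu>: "\<mu> * cnj \<mu> = 1"
    using root_of_unity_mult_cnj[OF n_pos assms(2)] .
  have pow: "cnj \<mu> ^ k = \<mu> ^ (n - k)" if "k < n" for k
  proof -
    have "cnj \<mu> ^ k = cnj \<mu> ^ k * \<mu> ^ (k + (n - k))"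
      using assms(2) that by simp
    also have "\<dots> = (\<mu> * cnj \<mu>) ^ k * \<mu> ^ (n - k)"
      unfolding power_add power_mult_distrib by simp
    finally show ?thesis by (simp add: \<mu>)
  qed
  have "proj \<mu> (T s f) x = (\<Sum>k<n. ?F (n - k))"
    unfolding proj_def using assms(1)
    by (intro sum.cong HOL.refl) (simp add: pow r_pow_s flip: T_mult)
  also have "\<dots> = (\<Sum>k<n. ?F k)"
    using assms by (intro sum_cyclic_reflect) (simp add: r_pow_n)
  also have "\<dots> = T s (proj (cnj \<mu>) f) x"
    unfolding proj_def using assms(1) by (subst T_sum) (auto simp: T_closed)
  finally show "proj \<mu> (T s f) x = T s (proj (cnj \<mu>) f) x" .
qed

text \<open>Orthogonality of the roots of unity annihilates every term except
  \<open>k = 0\<close>.\<close>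

lemma sum_proj:
  assumes "f \<in> V"
  shows "(\<Sum>\<mu> | \<mu> ^ n = 1. proj \<mu> f x) = of_nat n * f x"
proof -
  have "(\<Sum>\<mu> | \<mu> ^ n = 1. proj \<mu> f x)
      = (\<Sum>k<n. (\<Sum>\<mu> | \<mu> ^ n = 1. cnj \<mu> ^ k) * T (r [^] k) f x)"
    unfolding proj_def by (subst sum.swap) (simp add: sum_distrib_right)
  also have "\<dots> = (\<Sum>k<n. if k = 0 then of_nat n * f x else 0)"
    using assms T_one by (intro sum.cong HOL.refl) (auto simp: sum_roots_unity_power)
  also have "\<dots> = of_nat n * f x"
    using n_pos by simp
  finally show ?thesis .
qed

definition orders :: "nat set" where
  "orders = {j. \<exists>\<mu>. primitive_root j \<mu> \<and> (\<exists>f\<in>V. f \<noteq> (\<lambda>x. 0) \<and> T r f = (\<lambda>x. \<mu> * f x))}"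

lemma order_exists:
  assumes "f \<in> V" "\<mu> ^ n = 1" "proj \<mu> f \<noteq> (\<lambda>x. 0)"
  obtains j where "j \<in> orders" "primitive_root j \<mu>"
proof -
  obtain j where "primitive_root j \<mu>"
    using primitive_root_exists[OF n_pos assms(2)] .
  then show thesis
    using assms proj_closed T_r_proj that unfolding orders_def by blast
qed

lemma orders_dvd:
  assumes "j \<in> orders"
  shows "j dvd n"
proof -
  obtain \<mu> f where \<mu>: "primitive_root j \<mu>" "f \<in> V" "f \<noteq> (\<lambda>x. 0)" "T r f = (\<lambda>x. \<mu> * f x)"
    using assms by (auto simp: orders_def)
  have "f = (\<lambda>x. \<mu> ^ n * f x)"
    using T_r_pow_eigenvector[OF \<mu>(2,4), of n] \<mu>(2) T_one by (simp add: r_pow_n)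
  moreover obtain x where "f x \<noteq> 0" using \<mu>(3) by auto
  ultimately have "\<mu> ^ n = 1" by (metis mult_cancel_right1)
  then show ?thesis using \<mu>(1) by (simp add: primitive_root_def)
qed

text \<open>The element \<open>r [^] Lcm orders\<close> fixes all projections of a vector, hence the
  vector itself by \<open>sum_proj\<close>; faithfulness makes it trivial.\<close>

lemma Lcm_orders: "Lcm orders = n"
proof (rule dvd_antisym)
  show "Lcm orders dvd n"
    using orders_dvd by (intro Lcm_least)
  have "T (r [^] Lcm orders) f = f" if f: "f \<in> V" for f
  proof
    fix x
    have proj: "proj \<mu> (T (r [^] Lcm orders) f) = proj \<mu> f" if "\<mu> ^ n = 1" for \<mu>
    proof (cases "proj \<mu> f = (\<lambda>x. 0)")
      case True
      then show ?thesis using f that by (simp add: proj_T_r_pow)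
    next
      case False
      obtain j where "j \<in> orders" "primitive_root j \<mu>"
        using order_exists[OF f \<open>\<mu> ^ n = 1\<close> False] .
      then have "\<mu> ^ Lcm orders = 1" by (simp add: primitive_root_def)
      then show ?thesis using f that by (simp add: proj_T_r_pow)
    qed
    have "of_nat n * T (r [^] Lcm orders) f x = of_nat n * f x"
      using f proj by (simp add: T_closed flip: sum_proj)
    then show "T (r [^] Lcm orders) f x = f x"
      using n_pos by simp
  qed
  then have "r [^] Lcm orders = \<one>"
    by (intro T_faithful) auto
  then show "n dvd Lcm orders" by (rule r_pow_eq_one)
qed

text \<open>On the span of \<open>p = proj \<mu> f\<close> and \<open>q = T s (proj (cnj \<mu>) f)\<close> the operator is given by a
  \<open>2 \<times> 2\<close> matrix, whose characteristic equation is the conclusion.\<close>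

lemma characteristic_equation:
  fixes d :: "'a \<Rightarrow> real"
  defines "z \<equiv> \<lambda>\<mu>. \<Sum>k<n. complex_of_real (d (r [^] k)) * \<mu> ^ k"
    and "w \<equiv> \<lambda>\<mu>. \<Sum>k<n. complex_of_real (d (s \<otimes> r [^] k)) * \<mu> ^ k"
  assumes f: "f \<in> V" and \<mu>: "\<mu> ^ n = 1" "proj \<mu> f \<noteq> (\<lambda>x. 0)"
    and eig: "(\<lambda>x. \<Sum>g\<in>carrier G. complex_of_real (d g) * T g f x) = (\<lambda>x. l * f x)"
  shows "(z \<mu> - l) * (cnj (z \<mu>) - l) = w \<mu> * cnj (w \<mu>)"
proof -
  \<comment> \<open>This is \<open>proj \<nu>\<close> applied to the eigenvalue equation: rotations
    act by scalars, while reflections bring in the component for \<open>cnj \<nu>\<close>.\<close>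
  have eq: "z \<nu> * proj \<nu> f x + w (cnj \<nu>) * T s (proj (cnj \<nu>) f) x = l * proj \<nu> f x"
    if \<nu>: "\<nu> ^ n = 1" for \<nu> x
  proof -
    have cnj_\<nu>: "cnj \<nu> ^ n = 1"
      using \<nu> by (simp flip: complex_cnj_power)
    have "proj \<nu> (T (s \<otimes> r [^] k) f) = (\<lambda>x. cnj \<nu> ^ k * T s (proj (cnj \<nu>) f) x)" for k :: nat
      using f \<nu> cnj_\<nu>
      by (simp add: T_mult T_closed proj_T_s proj_T_r_pow T_mult_scalar proj_closed)
    moreover have "l * proj \<nu> f x = proj \<nu> (\<lambda>x. \<Sum>g\<in>carrier G. complex_of_real (d g) * T g f x) x"
      unfolding eig using f by (simp add: proj_mult)
    moreover have "\<dots> = (\<Sum>g\<in>carrier G. complex_of_real (d g) * proj \<nu> (T g f) x)"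
      using f finite_carrier by (subst proj_sum) (auto simp: T_closed)
    ultimately show ?thesis
      using f \<nu> by (simp add: sum_carrier proj_T_r_pow z_def w_def sum_distrib_right mult.assoc)
  qed
  have cnj_z: "z (cnj \<mu>) = cnj (z \<mu>)" and cnj_w: "w (cnj \<mu>) = cnj (w \<mu>)"
    by (simp_all add: z_def w_def)
  have cnj_\<mu>: "cnj \<mu> ^ n = 1"
    using \<mu>(1) by (simp flip: complex_cnj_power)
  define p q where "p = proj \<mu> f" and "q = T s (proj (cnj \<mu>) f)"
  have pV: "p \<in> V" and qV: "proj (cnj \<mu>) f \<in> V"
    using f by (simp_all add: p_def proj_closed)
  have eq1: "z \<mu> * p x + cnj (w \<mu>) * q x = l * p x" for x
    using eq[OF \<mu>(1), of x] by (simp add: p_def q_def cnj_w)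
  have eq2: "cnj (z \<mu>) * q x + w \<mu> * p x = l * q x" for x
  proof -
    have "(\<lambda>x. (cnj (z \<mu>)) * proj (cnj \<mu>) f x + w \<mu> * T s p x) = (\<lambda>x. l * proj (cnj \<mu>) f x)"
      using eq[OF cnj_\<mu>] by (simp add: p_def cnj_z)
    \<comment> \<open>Applying \<open>T s\<close> carries the equation from the eigenspace for
      \<open>cnj \<mu>\<close> to the one for \<open>\<mu>\<close>, which contains \<open>p\<close>
      and \<open>q\<close>.\<close>
    then have "T s (\<lambda>x. (cnj (z \<mu>)) * proj (cnj \<mu>) f x + w \<mu> * T s p x) = T s (\<lambda>x. l * proj (cnj \<mu>) f x)"
      by simp
    moreover have "T s (T s p) = p"
      using pV by (simp add: s_s T_one flip: T_mult)
    ultimately have "(\<lambda>x. cnj (z \<mu>) * q x + w \<mu> * p x) = (\<lambda>x. l * q x)"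
      using pV qV by (simp add: T_add_mult V_mult T_closed T_mult_scalar q_def)
    then show ?thesis by (rule fun_cong)
  qed
  obtain x where x: "p x \<noteq> 0"
    using \<mu>(2) by (auto simp: p_def)
  \<comment> \<open>This combination eliminates \<open>q\<close>, so \<open>p x \<noteq> 0\<close>
    suffices even when \<open>p\<close> and \<open>q\<close> are linearly dependent.\<close>
  have "((z \<mu> - l) * (cnj (z \<mu>) - l) - w \<mu> * cnj (w \<mu>)) * p x
      = (cnj (z \<mu>) - l) * (z \<mu> * p x + cnj (w \<mu>) * q x - l * p x)
        - cnj (w \<mu>) * (cnj (z \<mu>) * q x + w \<mu> * p x - l * q x)"
    by (simp add: algebra_simps)
  also have "\<dots> = 0"
    by (simp add: eq1 eq2)
  finally show ?thesis
    using x by simp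
qed

section \<open>The two inclusions for the hull spectrum\<close>

text \<open>The group elements concerned share the eigenvector \<open>f\<close>, so averaging them
  averages their eigenvalues.\<close>

lemma convex_hull_eigenvalues_subset:
  assumes f: "f \<in> V" "f \<noteq> (\<lambda>x. 0)"
  shows "convex hull {l. \<exists>g\<in>carrier G. T g f = (\<lambda>x. l * f x)} \<subseteq> op_hull_spectrum V (T ` carrier G)"
proof -
  define P where "P d l \<longleftrightarrow> (\<forall>g\<in>carrier G. 0 \<le> d g) \<and> sum d (carrier G) = 1 \<and>
    (\<forall>x. (\<Sum>g\<in>carrier G. complex_of_real (d g) * T g f x) = l * f x)" for d :: "'a \<Rightarrow> real" and l
  have "convex hull {l. \<exists>g\<in>carrier G. T g f = (\<lambda>x. l * f x)} \<subseteq> {l. \<exists>d. P d l}"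
  \<comment> \<open>The values attained on \<open>f\<close> by all weights \<open>d\<close> form a
    convex set, and a point mass gives the value of a single group element.\<close>
  proof (rule hull_minimal)
    show "{l. \<exists>g\<in>carrier G. T g f = (\<lambda>x. l * f x)} \<subseteq> {l. \<exists>d. P d l}"
    proof clarify
      fix l g assume g: "g \<in> carrier G" "T g f = (\<lambda>x. l * f x)"
      have "(\<Sum>h\<in>carrier G. complex_of_real (if h = g then 1 else 0) * T h f x) = l * f x" for x
      proof -
        have "(\<Sum>h\<in>carrier G. complex_of_real (if h = g then 1 else 0) * T h f x)
            = (\<Sum>h\<in>carrier G. if h = g then T h f x else 0)"
          by (intro sum.cong) auto
        then show ?thesis using g finite_carrier by simp
      qed
      moreover have "(\<Sum>h\<in>carrier G. if h = g then 1 else 0 :: real) = 1"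
        using g finite_carrier by simp
      ultimately have "P (\<lambda>h. if h = g then 1 else 0) l"
        unfolding P_def by (intro conjI allI ballI) simp_all
      then show "\<exists>d. P d l" by blast
    qed
    show "convex {l. \<exists>d. P d l}"
    proof (rule convexI)
      fix l m and u v :: real
      assume "l \<in> {l. \<exists>d. P d l}" "m \<in> {l. \<exists>d. P d l}" and uv: "0 \<le> u" "0 \<le> v" "u + v = 1"
      then obtain d e where d: "P d l" and e: "P e m"
        by auto
      let ?c = "\<lambda>g. u * d g + v * e g"
      have "(\<Sum>g\<in>carrier G. complex_of_real (?c g) * T g f x) = (u *\<^sub>R l + v *\<^sub>R m) * f x" for x
      proof -
        have "(\<Sum>g\<in>carrier G. complex_of_real (?c g) * T g f x)
            = of_real u * (\<Sum>g\<in>carrier G. complex_of_real (d g) * T g f x)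
              + of_real v * (\<Sum>g\<in>carrier G. complex_of_real (e g) * T g f x)"
          by (simp add: sum_distrib_left sum.distrib algebra_simps)
        also have "\<dots> = of_real u * (l * f x) + of_real v * (m * f x)"
          using d e by (simp only: P_def)
        finally show ?thesis
          by (simp add: scaleR_conv_of_real algebra_simps)
      qed
      moreover have "sum ?c (carrier G) = u * sum d (carrier G) + v * sum e (carrier G)"
        by (simp add: sum.distrib sum_distrib_left)
      ultimately have "P ?c (u *\<^sub>R l + v *\<^sub>R m)"
        using d e uv unfolding P_def by (intro conjI allI ballI) simp_all
      then show "u *\<^sub>R l + v *\<^sub>R m \<in> {l. \<exists>d. P d l}"
        by blast
    qed
  qed
  also have "\<dots> \<subseteq> op_hull_spectrum V (T ` carrier G)"
  proof clarify
    fix l d assume d: "P d l"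
    let ?A = "\<lambda>f x. \<Sum>g\<in>carrier G. complex_of_real (d g) * T g f x"
    have "?A \<in> op_convex_combs (T ` carrier G)"
      unfolding op_convex_combs_image[OF finite_carrier]
      using d by (intro CollectI exI[of _ d]) (simp add: P_def)
    moreover have "?A f = (\<lambda>x. l * f x)"
      using d by (intro ext) (simp only: P_def)
    ultimately show "l \<in> op_hull_spectrum V (T ` carrier G)"
      unfolding op_hull_spectrum_def using f
      by (intro CollectI bexI[of _ ?A] bexI[of _ f] conjI)
  qed
  finally show ?thesis .
qed

theorem op_hull_spectrum_eq:
  "op_hull_spectrum V (T ` carrier G) = roots_hull 2 \<union> (\<Union>j\<in>orders. roots_hull j)"
proof (intro subset_antisym subsetI)
  fix l assume "l \<in> op_hull_spectrum V (T ` carrier G)"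
  then obtain A f where A: "A \<in> op_convex_combs (T ` carrier G)" "A f = (\<lambda>x. l * f x)"
    and f: "f \<in> V" "f \<noteq> (\<lambda>x. 0)"
    unfolding op_hull_spectrum_def by blast
  obtain d where d: "\<forall>g\<in>carrier G. 0 \<le> d g" "sum d (carrier G) = 1"
    and A_eq: "A = (\<lambda>f x. \<Sum>g\<in>carrier G. complex_of_real (d g) * T g f x)"
    using A(1) unfolding op_convex_combs_image[OF finite_carrier] mem_Collect_eq
    by (elim exE conjE) (rule that)
  have eig: "(\<lambda>x. \<Sum>g\<in>carrier G. complex_of_real (d g) * T g f x) = (\<lambda>x. l * f x)"
    using A(2) unfolding A_eq .
  obtain x where "f x \<noteq> 0" using f(2) by auto
  \<comment> \<open>The projections add up to \<open>n\<close> times \<open>f\<close>, so one of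
    them is nonzero at \<open>x\<close>.\<close>
  then have "(\<Sum>\<mu> | \<mu> ^ n = 1. proj \<mu> f x) \<noteq> 0"
    using f(1) n_pos by (simp add: sum_proj)
  then obtain \<mu> where \<mu>: "\<mu> ^ n = 1" "proj \<mu> f x \<noteq> 0"
    by (auto elim: sum.not_neutral_contains_not_neutral)
  then have proj: "proj \<mu> f \<noteq> (\<lambda>x. 0)" by auto
  obtain j where j: "j \<in> orders" "primitive_root j \<mu>"
    using order_exists[OF f(1) \<mu>(1) proj] .
  have "l \<in> roots_hull 2 \<union> roots_hull j"
  proof (rule characteristic_root_in_roots_hull[OF j(2) _ _ _ HOL.refl HOL.refl])
    show "(\<Sum>k<n. d (r [^] k)) + (\<Sum>k<n. d (s \<otimes> r [^] k)) = 1"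
      using d(2) by (simp add: sum_carrier)
  qed (use d(1) in \<open>simp_all add: characteristic_equation[OF f(1) \<mu>(1) proj eig] del: cnj_sum\<close>)
  then show "l \<in> roots_hull 2 \<union> (\<Union>j\<in>orders. roots_hull j)"
    using j(1) by blast
next
  fix l assume "l \<in> roots_hull 2 \<union> (\<Union>j\<in>orders. roots_hull j)"
  then show "l \<in> op_hull_spectrum V (T ` carrier G)"
  proof
    assume l: "l \<in> roots_hull 2"
    have "s \<noteq> \<one>"
      using s_r_pow_neq_one[of 0] by auto
    then obtain f where f: "f \<in> V" "T s f \<noteq> f"
      using T_faithful[OF s_closed] by metis
    \<comment> \<open>Antisymmetrising a vector moved by \<open>s\<close> gives a nonzero vector
      with eigenvalue -1 under \<open>T s\<close>; the identity element supplies the eigenvalue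
      1.\<close>
    define h where "h = (\<lambda>x. f x + (-1) * T s f x)"
    have hV: "h \<in> V"
      unfolding h_def using f by (intro V_add_mult T_closed) auto
    have "T s (T s f) = f"
      using f by (simp add: s_s T_one flip: T_mult)
    then have T_s_h: "T s h = (\<lambda>x. -1 * h x)"
      unfolding h_def using f by (subst T_add_mult) (auto simp: T_closed)
    have "-1 \<in> {l. \<exists>g\<in>carrier G. T g h = (\<lambda>x. l * h x)}"
      by (intro CollectI bexI[of _ s] T_s_h s_closed)
    moreover have "1 \<in> {l. \<exists>g\<in>carrier G. T g h = (\<lambda>x. l * h x)}"
      using hV by (intro CollectI bexI[of _ \<one>]) (simp_all add: T_one)
    ultimately have "{1, -1} \<subseteq> {l. \<exists>g\<in>carrier G. T g h = (\<lambda>x. l * h x)}"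
      by simp
    moreover have "h \<noteq> (\<lambda>x. 0)"
      using f(2) by (auto simp: h_def fun_eq_iff) metis
    ultimately show ?thesis
      by (intro subsetD[OF convex_hull_eigenvalues_subset[OF hV]]
          subsetD[OF hull_mono l[unfolded roots_hull_2_eq]])
  next
    assume "l \<in> (\<Union>j\<in>orders. roots_hull j)"
    then obtain j \<mu> f where l: "l \<in> roots_hull j" and \<mu>: "primitive_root j \<mu>"
      and f: "f \<in> V" "f \<noteq> (\<lambda>x. 0)" "T r f = (\<lambda>x. \<mu> * f x)"
      by (auto simp: orders_def)
    \<comment> \<open>The powers of \<open>\<mu>\<close> exhaust the roots of unity of exponent
      \<open>j\<close>, and they are the eigenvalues of the powers of \<open>r\<close> on
      \<open>f\<close>.\<close>
    have "{z. z ^ j = 1} \<subseteq> {l. \<exists>g\<in>carrier G. T g f = (\<lambda>x. l * f x)}"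
    proof clarify
      fix z :: complex assume "z ^ j = 1"
      then obtain k where "z = \<mu> ^ k"
        by (rule primitive_root_powers[OF \<mu>])
      then show "\<exists>g\<in>carrier G. T g f = (\<lambda>x. z * f x)"
        by (intro bexI[of _ "r [^] k"]) (simp_all add: T_r_pow_eigenvector[OF f(1,3)])
    qed
    then show ?thesis
      by (intro subsetD[OF convex_hull_eigenvalues_subset[OF f(1,2)]]
          subsetD[OF hull_mono l[unfolded roots_hull_def]])
  qed
qed

end

section \<open>The regular representation\<close>

lemma primitive_root_unique: "primitive_root j z \<Longrightarrow> primitive_root k z \<Longrightarrow> j = k"
  unfolding primitive_root_def by (metis dvd_antisym dvd_refl)

lemma (in dihedral) dihedral_rep_regular: "dihedral_rep G n r s (carrier_funs G) (regular_rep G)"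
proof unfold_locales
  fix g assume g: "g \<in> carrier G" and fixed: "\<And>f. f \<in> carrier_funs G \<Longrightarrow> regular_rep G g f = f"
  \<comment> \<open>An element \<open>g\<close> moves the point mass at \<open>\<one>\<close> to the
    one at \<open>g\<close>, so only \<open>\<one>\<close> fixes it.\<close>
  define f where "f x = (if x = \<one> then 1 else 0 :: complex)" for x
  have "f \<in> carrier_funs G"
    by (auto simp: f_def carrier_funs_def)
  then have "regular_rep G g f \<one> = f \<one>"
    by (simp add: fixed)
  then have "inv g = \<one>"
    using g by (simp add: regular_rep_def f_def split: if_splits)
  then show "g = \<one>"
    using g inv_eq_1_iff by blast
next
  fix g h f assume "g \<in> carrier G" "h \<in> carrier G" "f \<in> carrier_funs G"
  then show "regular_rep G (g \<otimes> h) f = regular_rep G g (regular_rep G h f)"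
    by (auto simp: regular_rep_def inv_mult_group m_assoc)
qed (auto simp: carrier_funs_def regular_rep_def)

text \<open>All orders divide \<open>n\<close>, so their hulls lie in \<open>roots_hull n\<close>;
  the order \<open>n\<close> itself occurs because the point mass at \<open>\<one>\<close> has a
  nonzero component for a primitive root \<open>\<omega>\<close>.\<close>

theorem (in dihedral) maximal_hull_spectrum_eq:
  "maximal_hull_spectrum G = roots_hull 2 \<union> roots_hull n"
proof -
  interpret rep: dihedral_rep G n r s "carrier_funs G" "regular_rep G"
    by (rule dihedral_rep_regular)
  define \<omega> where "\<omega> = cis (2 * pi / n)"
  have \<omega>: "primitive_root n \<omega>"
    unfolding \<omega>_def using n_pos by (rule primitive_root_cis)
  then have \<omega>_n: "\<omega> ^ n = 1" by (simp add: primitive_root_def)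
  define f where "f x = (if x = \<one> then 1 else 0 :: complex)" for x
  have f: "f \<in> carrier_funs G"
    by (auto simp: f_def carrier_funs_def)
  have "regular_rep G (r [^] k) f \<one> = (if k = 0 then 1 else 0)" if "k < n" for k
  proof -
    have "r [^] k = \<one> \<longleftrightarrow> k = 0"
      using that r_pow_eq_one[of k] nat_dvd_not_less[of k n] by auto
    then show ?thesis
      by (simp add: regular_rep_def f_def inv_eq_1_iff)
  qed
  \<comment> \<open>The translates of the point mass by \<open>r [^] k\<close> vanish at
    \<open>\<one>\<close> unless \<open>k = 0\<close>.\<close>
  then have "rep.proj \<omega> f \<one> = (\<Sum>k<n. if k = 0 then 1 else 0)"
    unfolding rep.proj_def by (intro sum.cong) auto
  then have "rep.proj \<omega> f \<one> = 1"
    using n_pos by simp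
  then have "rep.proj \<omega> f \<noteq> (\<lambda>x. 0)"
    by auto
  then obtain j where "j \<in> rep.orders" "primitive_root j \<omega>"
    by (rule rep.order_exists[OF f \<omega>_n])
  then have "n \<in> rep.orders"
    using primitive_root_unique[OF \<omega>] by simp
  moreover have "roots_hull j \<subseteq> roots_hull n" if "j \<in> rep.orders" for j
    using rep.orders_dvd[OF that] by (rule roots_hull_mono)
  ultimately have "(\<Union>j\<in>rep.orders. roots_hull j) = roots_hull n"
    by blast
  then show ?thesis
    unfolding maximal_hull_spectrum_def rep.op_hull_spectrum_eq by simp
qed

section \<open>Matrix representations\<close>

text \<open>Vectors of length \<open>m\<close> become functions on \<open>nat\<close> that vanish
  from \<open>m\<close> on, hence the default value 0; this fits matrices into
  \<open>dihedral_rep\<close>.\<close>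

definition mat_op :: "nat \<Rightarrow> complex mat \<Rightarrow> (nat \<Rightarrow> complex) \<Rightarrow> nat \<Rightarrow> complex" where
  "mat_op m A f = (\<lambda>i. if i < m then \<Sum>j<m. A $$ (i, j) * f j else 0)"

definition fin_funs :: "nat \<Rightarrow> (nat \<Rightarrow> complex) set" where
  "fin_funs m = {f. \<forall>i\<ge>m. f i = 0}"

lemma fin_funs_nonzero_less: "f \<in> fin_funs m \<Longrightarrow> f i \<noteq> 0 \<Longrightarrow> i < m"
  unfolding fin_funs_def by (rule ccontr) auto

lemma eigenvalue_iff_mat_op:
  assumes A: "A \<in> carrier_mat m m"
  shows "eigenvalue A z \<longleftrightarrow> (\<exists>f\<in>fin_funs m. f \<noteq> (\<lambda>x. 0) \<and> mat_op m A f = (\<lambda>x. z * f x))"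
proof
  assume "eigenvalue A z"
  then obtain v where v: "v \<in> carrier_vec m" "v \<noteq> 0\<^sub>v m" "A *\<^sub>v v = z \<cdot>\<^sub>v v"
    using A by (auto simp: eigenvalue_def eigenvector_def)
  define f where "f i = (if i < m then v $ i else 0)" for i
  have "mat_op m A f i = z * f i" for i
  proof (cases "i < m")
    case True
    have "(A *\<^sub>v v) $ i = (\<Sum>j<m. A $$ (i, j) * v $ j)"
      using A v(1) True by (auto simp: scalar_prod_def lessThan_atLeast0)
    then show ?thesis
      using True v(1) unfolding v(3) by (simp add: mat_op_def f_def)
  qed (simp add: mat_op_def f_def)
  moreover have "f \<noteq> (\<lambda>x. 0)"
  proof
    assume "f = (\<lambda>x. 0)"
    then have "v $ i = 0" if "i < m" for i
      using that by (metis f_def)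
    then show False using v(1,2) by (auto intro: eq_vecI)
  qed
  ultimately show "\<exists>f\<in>fin_funs m. f \<noteq> (\<lambda>x. 0) \<and> mat_op m A f = (\<lambda>x. z * f x)"
    by (intro bexI[of _ f]) (auto simp: fin_funs_def f_def)
next
  assume "\<exists>f\<in>fin_funs m. f \<noteq> (\<lambda>x. 0) \<and> mat_op m A f = (\<lambda>x. z * f x)"
  then obtain f where f: "f \<in> fin_funs m" "f \<noteq> (\<lambda>x. 0)" "mat_op m A f = (\<lambda>x. z * f x)"
    by blast
  from f(2) obtain i where i: "f i \<noteq> 0" by auto
  with f(1) have "i < m" by (rule fin_funs_nonzero_less)
  have "A *\<^sub>v vec m f = z \<cdot>\<^sub>v vec m f"
  proof (rule eq_vecI)
    fix i assume "i < dim_vec (z \<cdot>\<^sub>v vec m f)"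
    then have "i < m" by simp
    then have "(A *\<^sub>v vec m f) $ i = mat_op m A f i"
      using A by (auto simp: scalar_prod_def lessThan_atLeast0 mat_op_def)
    then show "(A *\<^sub>v vec m f) $ i = (z \<cdot>\<^sub>v vec m f) $ i"
      using \<open>i < m\<close> by (simp add: f(3))
  qed (use A in simp)
  moreover have "vec m f $ i \<noteq> 0\<^sub>v m $ i"
    using i \<open>i < m\<close> by simp
  then have "vec m f \<noteq> 0\<^sub>v m" by metis
  ultimately show "eigenvalue A z"
    using A unfolding eigenvalue_def eigenvector_def by (intro exI[of _ "vec m f"]) auto
qed

text \<open>Both sets of convex combinations are parametrised by the same weights on
  \<open>I\<close>, and \<open>mat_op\<close> is linear in the matrix.\<close>

lemma hull_spectrum_eq_op_hull_spectrum:
  assumes I: "finite I"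
  shows "hull_spectrum m (\<rho> ` I) = op_hull_spectrum (fin_funs m) ((\<lambda>g. mat_op m (\<rho> g)) ` I)"
proof -
  define M where "M d = mat m m (\<lambda>(i, j). \<Sum>g\<in>I. complex_of_real (d g) * \<rho> g $$ (i, j))" for d
  define N where "N d = (\<lambda>f x. \<Sum>g\<in>I. complex_of_real (d g) * mat_op m (\<rho> g) f x)" for d
  define W where "W = {d. (\<forall>g\<in>I. 0 \<le> d g) \<and> sum d I = (1 :: real)}"
  have "mat_convex_combs m (\<rho> ` I) = M ` W"
    unfolding mat_convex_combs_image[OF I] W_def M_def by (rule setcompr_eq_image)
  moreover have "op_convex_combs ((\<lambda>g. mat_op m (\<rho> g)) ` I) = N ` W"
    unfolding op_convex_combs_image[OF I] W_def N_def by (rule setcompr_eq_image)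
  moreover have "N d f = mat_op m (M d) f" for d f
  proof
    fix i
    have "(\<Sum>g\<in>I. complex_of_real (d g) * (\<Sum>j<m. \<rho> g $$ (i, j) * f j))
        = (\<Sum>j<m. (\<Sum>g\<in>I. complex_of_real (d g) * \<rho> g $$ (i, j)) * f j)"
      unfolding sum_distrib_left sum_distrib_right
      by (subst sum.swap) (simp only: mult.assoc)
    then show "N d f i = mat_op m (M d) f i"
      by (simp add: N_def M_def mat_op_def)
  qed
  moreover have "eigenvalue (M d) z \<longleftrightarrow>
      (\<exists>f\<in>fin_funs m. f \<noteq> (\<lambda>x. 0) \<and> mat_op m (M d) f = (\<lambda>x. z * f x))" for d z
    by (rule eigenvalue_iff_mat_op) (simp add: M_def)
  ultimately show ?thesis
    unfolding hull_spectrum_def op_hull_spectrum_def by simp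
qed

lemma GL_simps:
  "\<one>\<^bsub>GL m\<^esub> = 1\<^sub>m m" "A \<otimes>\<^bsub>GL m\<^esub> B = A * B"
  by (simp_all add: GL_def units_of_def ring_mat_simps)

lemma carrier_GL: "A \<in> carrier (GL m) \<longleftrightarrow>
  A \<in> carrier_mat m m \<and> (\<exists>B\<in>carrier_mat m m. B * A = 1\<^sub>m m \<and> A * B = 1\<^sub>m m)"
  by (auto simp: GL_def units_of_def Units_def ring_mat_simps)

lemma group_GL: "group (GL m)"
proof -
  interpret ring "ring_mat TYPE(complex) m ()" by (rule ring_mat)
  show ?thesis unfolding GL_def by (rule units_group)
qed

lemma mat_op_one: "f \<in> fin_funs m \<Longrightarrow> mat_op m (1\<^sub>m m) f = f"
  by (force simp: mat_op_def fin_funs_def if_distrib[of "\<lambda>x. x * _"] cong: if_cong)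

lemma mat_op_mult:
  assumes "A \<in> carrier_mat m m" "B \<in> carrier_mat m m"
  shows "mat_op m (A * B) f = mat_op m A (mat_op m B f)"
proof
  fix i
  show "mat_op m (A * B) f i = mat_op m A (mat_op m B f) i"
  proof (cases "i < m")
    case True
    have "(\<Sum>k<m. (A * B) $$ (i, k) * f k) = (\<Sum>k<m. \<Sum>j<m. A $$ (i, j) * (B $$ (j, k) * f k))"
      using assms True
      by (intro sum.cong HOL.refl)
         (auto simp: scalar_prod_def lessThan_atLeast0 sum_distrib_right mult.assoc)
    also have "\<dots> = (\<Sum>j<m. A $$ (i, j) * (\<Sum>k<m. B $$ (j, k) * f k))"
      unfolding sum_distrib_left by (rule sum.swap)
    finally show ?thesis
      using True by (simp add: mat_op_def)
  qed (simp add: mat_op_def)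
qed

text \<open>Testing on the unit vector at \<open>k\<close> reads off column
  \<open>k\<close>.\<close>

lemma mat_op_eq_imp_one:
  assumes A: "A \<in> carrier_mat m m" and fixed: "\<And>f. f \<in> fin_funs m \<Longrightarrow> mat_op m A f = f"
  shows "A = 1\<^sub>m m"
proof (rule eq_matI)
  fix i k assume "i < dim_row (1\<^sub>m m :: complex mat)" "k < dim_col (1\<^sub>m m :: complex mat)"
  then have ik: "i < m" "k < m" by auto
  define f where "f j = (if j = k then 1 else 0 :: complex)" for j
  have "mat_op m A f i = f i"
    using ik by (subst fixed) (auto simp: fin_funs_def f_def)
  moreover have "mat_op m A f i = A $$ (i, k)"
    using ik by (simp add: mat_op_def f_def if_distrib[of "\<lambda>x. _ * x"] cong: if_cong)
  ultimately show "A $$ (i, k) = 1\<^sub>m m $$ (i, k)"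
    using ik by (auto simp: f_def)
qed (use A in auto)

lemma (in dihedral) dihedral_rep_mat_op:
  assumes \<rho>: "\<rho> \<in> hom G (GL m)" "inj_on \<rho> (carrier G)"
  shows "dihedral_rep G n r s (fin_funs m) (\<lambda>g. mat_op m (\<rho> g))"
proof unfold_locales
  have \<rho>_one: "\<rho> \<one> = 1\<^sub>m m"
    using hom_one[OF \<rho>(1) is_group group_GL] by (simp add: GL_simps)
  have carrier: "\<rho> g \<in> carrier_mat m m" if "g \<in> carrier G" for g
    using hom_in_carrier[OF \<rho>(1) that] by (simp add: carrier_GL)
  show "mat_op m (\<rho> \<one>) f = f" if "f \<in> fin_funs m" for f
    using that by (simp add: \<rho>_one mat_op_one)
  show "mat_op m (\<rho> (g \<otimes> h)) f = mat_op m (\<rho> g) (mat_op m (\<rho> h) f)"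
    if "g \<in> carrier G" "h \<in> carrier G" for g h f
    using that by (simp add: hom_mult[OF \<rho>(1)] GL_simps mat_op_mult carrier)
  show "g = \<one>" if "g \<in> carrier G" "\<And>f. f \<in> fin_funs m \<Longrightarrow> mat_op m (\<rho> g) f = f" for g
  proof (rule inj_onD[OF \<rho>(2)])
    show "\<rho> g = \<rho> \<one>"
      unfolding \<rho>_one using that carrier by (intro mat_op_eq_imp_one)
  qed (use that in auto)
  show "mat_op m (\<rho> g) (\<lambda>x. f x + c * h x) = (\<lambda>x. mat_op m (\<rho> g) f x + c * mat_op m (\<rho> g) h x)"
    for g f h c
    by (auto simp: mat_op_def sum.distrib sum_distrib_left distrib_left mult.left_commute)
qed (auto simp: fin_funs_def mat_op_def)

section \<open>Monomial matrices and block representations\<close>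

definition monomial_mat :: "nat \<Rightarrow> (nat \<Rightarrow> complex) \<Rightarrow> (nat \<Rightarrow> nat) \<Rightarrow> complex mat" where
  "monomial_mat m d \<tau> = mat m m (\<lambda>(a, b). if b = \<tau> a then d a else 0)"

lemma monomial_mat_carrier [simp]: "monomial_mat m d \<tau> \<in> carrier_mat m m"
  by (simp add: monomial_mat_def)

lemma monomial_mat_cong:
  "(\<And>a. a < m \<Longrightarrow> d a = e a) \<Longrightarrow> (\<And>a. a < m \<Longrightarrow> \<tau> a = \<sigma> a) \<Longrightarrow>
    monomial_mat m d \<tau> = monomial_mat m e \<sigma>"
  unfolding monomial_mat_def by (intro eq_matI) auto

lemma monomial_mat_one: "monomial_mat m (\<lambda>_. 1) (\<lambda>a. a) = 1\<^sub>m m"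
  unfolding monomial_mat_def by (intro eq_matI) auto

text \<open>Row \<open>a\<close> of the first factor selects row \<open>\<tau> a\<close> of the
  second, so \<open>\<tau>\<close> is applied before \<open>\<sigma>\<close>.\<close>

lemma monomial_mat_mult:
  assumes "\<And>a. a < m \<Longrightarrow> \<tau> a < m"
  shows "monomial_mat m d \<tau> * monomial_mat m e \<sigma> = monomial_mat m (\<lambda>a. d a * e (\<tau> a)) (\<lambda>a. \<sigma> (\<tau> a))"
proof (rule eq_matI)
  fix a c
  assume "a < dim_row (monomial_mat m (\<lambda>a. d a * e (\<tau> a)) (\<lambda>a. \<sigma> (\<tau> a)))"
    "c < dim_col (monomial_mat m (\<lambda>a. d a * e (\<tau> a)) (\<lambda>a. \<sigma> (\<tau> a)))"
  then have ac: "a < m" "c < m" by (auto simp: monomial_mat_def)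
  have "(monomial_mat m d \<tau> * monomial_mat m e \<sigma>) $$ (a, c)
      = (\<Sum>b = 0..<m. (if b = \<tau> a then d a else 0) * (if c = \<sigma> b then e b else 0))"
    using ac by (simp add: monomial_mat_def scalar_prod_def)
  also have "\<dots> = (\<Sum>b = 0..<m. if b = \<tau> a then d a * (if c = \<sigma> b then e b else 0) else 0)"
    by (intro sum.cong) auto
  also have "\<dots> = d a * (if c = \<sigma> (\<tau> a) then e (\<tau> a) else 0)"
    using assms ac by simp
  finally show "(monomial_mat m d \<tau> * monomial_mat m e \<sigma>) $$ (a, c)
      = monomial_mat m (\<lambda>a. d a * e (\<tau> a)) (\<lambda>a. \<sigma> (\<tau> a)) $$ (a, c)"
    using ac by (simp add: monomial_mat_def)
qed (auto simp: monomial_mat_def)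

lemma mat_op_diagonal:
  "f \<in> fin_funs m \<Longrightarrow> mat_op m (monomial_mat m d (\<lambda>a. a)) f = (\<lambda>a. if a < m then d a * f a else 0)"
  by (auto simp: mat_op_def monomial_mat_def if_distrib[of "\<lambda>x. x * _"] cong: if_cong)

text \<open>The indices \<open>a\<close> and \<open>length js + a\<close> span a \<open>2 \<times> 2\<close> block on which \<open>r\<close> acts as
  \<open>diag (\<zeta>, cnj \<zeta>)\<close>, with \<open>\<zeta>\<close> a primitive root of unity of order \<open>js ! a\<close>, and \<open>s\<close> as the swap.\<close>

definition block_root :: "nat list \<Rightarrow> nat \<Rightarrow> complex" where
  "block_root js a = (if a < length js then cis (2 * pi / js ! a)
     else cnj (cis (2 * pi / js ! (a - length js))))"

definition block_swap :: "nat list \<Rightarrow> nat \<Rightarrow> nat" where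
  "block_swap js a = (if a < length js then a + length js else a - length js)"

lemma block_swap:
  assumes "a < 2 * length js"
  shows "block_swap js a < 2 * length js" "block_swap js (block_swap js a) = a"
    "block_root js (block_swap js a) = cnj (block_root js a)"
  using assms by (auto simp: block_swap_def block_root_def)

lemma block_root_mult_cnj: "block_root js a * cnj (block_root js a) = 1"
  by (simp add: block_root_def cis_cnj cis_mult)

lemma primitive_block_root:
  assumes "a < 2 * length js" "\<forall>j\<in>set js. j > 0"
  obtains j where "j \<in> set js" "primitive_root j (block_root js a)"
proof (cases "a < length js")
  case True
  then show thesis
    using assms that[of "js ! a"] primitive_root_cis[of "js ! a"] by (simp add: block_root_def)
next
  case False
  then have "a - length js < length js" using assms by simp
  then show thesis
    using False assms that[of "js ! (a - length js)"] primitive_root_cis[of "js ! (a - length js)"]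
    by (simp add: block_root_def primitive_root_cnj del: cis_cnj)
qed

text \<open>The orders in \<open>js\<close> divide \<open>n\<close> and the swap conjugates each
  root to its inverse, so the matrices satisfy the relators and the universal property yields
  \<open>\<rho>\<close>. By the normal form, the two formulas describe \<open>\<rho>\<close> on the
  whole group when \<open>n > 0\<close>.\<close>

lemma block_rep:
  assumes js: "\<forall>j\<in>set js. j > 0 \<and> j dvd n"
  defines "m \<equiv> 2 * length js"
  obtains \<rho> where "\<rho> \<in> hom (dihedral_group n) (GL m)"
    and "\<And>k. \<rho> (dihedral_r n [^]\<^bsub>dihedral_group n\<^esub> k) = monomial_mat m (\<lambda>a. block_root js a ^ k) (\<lambda>a. a)"
    and "\<And>k. \<rho> (dihedral_s n \<otimes>\<^bsub>dihedral_group n\<^esub> dihedral_r n [^]\<^bsub>dihedral_group n\<^esub> k)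
      = monomial_mat m (\<lambda>a. block_root js (block_swap js a) ^ k) (block_swap js)"
proof -
  interpret GL: group "GL m" by (rule group_GL)
  define R where "R = monomial_mat m (block_root js) (\<lambda>a. a)"
  define S where "S = monomial_mat m (\<lambda>_. 1) (block_swap js)"
  define \<phi> where "\<phi> = case_dihedral_gen R S"
  have swap: "block_swap js a < m" "block_swap js (block_swap js a) = a"
    "block_root js (block_swap js a) = cnj (block_root js a)" if "a < m" for a
    using that block_swap unfolding m_def by auto
  have SS: "S * S = 1\<^sub>m m"
    unfolding S_def monomial_mat_one[symmetric]
    by (subst monomial_mat_mult) (auto simp: swap intro!: monomial_mat_cong)
  have R_inverse: "R * monomial_mat m (\<lambda>a. cnj (block_root js a)) (\<lambda>a. a) = 1\<^sub>m m"
    "monomial_mat m (\<lambda>a. cnj (block_root js a)) (\<lambda>a. a) * R = 1\<^sub>m m"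
    unfolding R_def monomial_mat_one[symmetric]
    by (subst monomial_mat_mult;
        simp add: block_root_mult_cnj mult.commute[of "cnj (block_root js _)"])+
  have \<phi>: "\<phi> x \<in> carrier (GL m)" for x
  proof (cases x)
    case Gen_r
    then show ?thesis
      unfolding carrier_GL \<phi>_def using R_inverse
      by (auto simp: R_def intro!: bexI[of _ "monomial_mat m (\<lambda>a. cnj (block_root js a)) (\<lambda>a. a)"])
  next
    case Gen_s
    then show ?thesis
      unfolding carrier_GL \<phi>_def using SS by (auto simp: S_def intro!: bexI[of _ S])
  qed
  have SR: "S * R = monomial_mat m (\<lambda>a. cnj (block_root js a)) (block_swap js)"
    unfolding S_def R_def by (subst monomial_mat_mult) (auto simp: swap intro!: monomial_mat_cong)
  have eval_r: "word_eval (GL m) \<phi> (replicate k (True, Gen_r)) = monomial_mat m (\<lambda>a. block_root js a ^ k) (\<lambda>a. a)"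
    for k
    by (induction k) (simp_all add: GL_simps monomial_mat_one \<phi>_def R_def monomial_mat_mult)
  have eval_s_r: "word_eval (GL m) \<phi> ((True, Gen_s) # replicate k (True, Gen_r))
      = monomial_mat m (\<lambda>a. block_root js (block_swap js a) ^ k) (block_swap js)" for k
    unfolding word_eval.simps eval_r by (simp add: GL_simps \<phi>_def S_def monomial_mat_mult swap)
  have "block_root js a ^ n = 1" if "a < m" for a
  proof -
    have a: "a < 2 * length js" "\<forall>j\<in>set js. j > 0"
      using that js by (auto simp: m_def)
    obtain j where "j \<in> set js" "primitive_root j (block_root js a)"
      by (rule primitive_block_root[OF a])
    then show ?thesis
      using js by (simp add: primitive_root_def)
  qed
  then have rel_r: "word_eval (GL m) \<phi> (replicate n (True, Gen_r)) = \<one>\<^bsub>GL m\<^esub>"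
    unfolding eval_r GL_simps monomial_mat_one[symmetric] by (intro monomial_mat_cong) auto
  have "S * (R * (S * R)) = 1\<^sub>m m"
  proof -
    \<comment> \<open>The swap pairs each root with its conjugate, so the diagonal factors on both
      sides cancel.\<close>
    have "R * (S * R) = S"
      unfolding SR unfolding R_def S_def
      by (subst monomial_mat_mult) (auto simp: block_root_mult_cnj)
    then show ?thesis by (simp add: SS)
  qed
  moreover have "R * 1\<^sub>m m = R" "S * 1\<^sub>m m = S"
    unfolding R_def S_def by (rule right_mult_one_mat[OF monomial_mat_carrier])+
  ultimately have rel: "word_eval (GL m) \<phi> w = \<one>\<^bsub>GL m\<^esub>" if "w \<in> dihedral_relators n" for w
    using that rel_r SS by (auto simp: GL_simps \<phi>_def)
  obtain \<rho> where \<rho>: "\<rho> \<in> hom (presented_group (dihedral_relators n)) (GL m)"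
    and \<rho>_all: "\<forall>w. \<rho> (word_class (dihedral_relators n) w) = word_eval (GL m) \<phi> w"
    using GL.presented_group_hom[OF \<phi> rel] .
  note \<rho>_eval = \<rho>_all[rule_format]
  show thesis
  proof
    show "\<rho> \<in> hom (dihedral_group n) (GL m)"
      unfolding dihedral_group_eq by (rule \<rho>)
    show "\<rho> (dihedral_r n [^]\<^bsub>dihedral_group n\<^esub> k) = monomial_mat m (\<lambda>a. block_root js a ^ k) (\<lambda>a. a)" for k
      unfolding dihedral_r_pow \<rho>_eval eval_r ..
    have "dihedral_s n \<otimes>\<^bsub>dihedral_group n\<^esub> dihedral_r n [^]\<^bsub>dihedral_group n\<^esub> k
        = word_class (dihedral_relators n) ((True, Gen_s) # replicate k (True, Gen_r))" for k
      unfolding dihedral_r_pow unfolding dihedral_group_eq mult_presented_group by simp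
    then show "\<rho> (dihedral_s n \<otimes>\<^bsub>dihedral_group n\<^esub> dihedral_r n [^]\<^bsub>dihedral_group n\<^esub> k)
        = monomial_mat m (\<lambda>a. block_root js (block_swap js a) ^ k) (block_swap js)" for k
      unfolding \<rho>_eval[symmetric] eval_s_r[symmetric] by simp
  qed
qed

lemma monomial_mat_eq_one:
  assumes "monomial_mat m d \<tau> = 1\<^sub>m m" "a < m"
  shows "\<tau> a = a" "d a = 1"
proof -
  have "monomial_mat m d \<tau> $$ (a, a) = 1"
    using assms by simp
  then have "(if a = \<tau> a then d a else 0) = 1"
    using assms(2) by (simp add: monomial_mat_def)
  then show "\<tau> a = a" "d a = 1"
    by (auto split: if_splits)
qed

section \<open>The presented group as a dihedral group, and faithful block representations\<close>

text \<open>A model is required only to exclude a collapse. One block with a root of order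
  \<open>n\<close> serves: \<open>r [^] k\<close> is diagonal with that root to the power
  \<open>k\<close>, and reflections are off-diagonal.\<close>

lemma dihedral_dihedral_group:
  assumes "n > 0"
  shows "dihedral (dihedral_group n) n (dihedral_r n) (dihedral_s n)"
proof -
  interpret group "dihedral_group n" by (rule group_dihedral_group)
  let ?m = "2 * length [n]"
  obtain \<rho> where \<rho>: "\<rho> \<in> hom (dihedral_group n) (GL ?m)"
    "\<And>k. \<rho> (dihedral_r n [^]\<^bsub>dihedral_group n\<^esub> k) = monomial_mat ?m (\<lambda>a. block_root [n] a ^ k) (\<lambda>a. a)"
    "\<And>k. \<rho> (dihedral_s n \<otimes>\<^bsub>dihedral_group n\<^esub> dihedral_r n [^]\<^bsub>dihedral_group n\<^esub> k)
      = monomial_mat ?m (\<lambda>a. block_root [n] (block_swap [n] a) ^ k) (block_swap [n])"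
    using block_rep[of "[n]" n] assms by auto
  have \<rho>_one: "\<rho> \<one>\<^bsub>dihedral_group n\<^esub> = 1\<^sub>m ?m"
    using hom_one[OF \<rho>(1) is_group group_GL] by (simp add: GL_simps)
  show ?thesis
  proof unfold_locales
    fix k :: nat
    show "n dvd k" if "dihedral_r n [^]\<^bsub>dihedral_group n\<^esub> k = \<one>\<^bsub>dihedral_group n\<^esub>"
    proof -
      have "monomial_mat ?m (\<lambda>a. block_root [n] a ^ k) (\<lambda>a. a) = 1\<^sub>m ?m"
        using \<rho>(2)[of k] \<rho>_one that by simp
      then have "block_root [n] 0 ^ k = 1"
        by (rule monomial_mat_eq_one) simp
      then show ?thesis
        using primitive_root_cis[OF assms] by (simp add: block_root_def primitive_root_def)
    qed
    show "dihedral_s n \<otimes>\<^bsub>dihedral_group n\<^esub> dihedral_r n [^]\<^bsub>dihedral_group n\<^esub> k \<noteq> \<one>\<^bsub>dihedral_group n\<^esub>"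
    proof
      assume "dihedral_s n \<otimes>\<^bsub>dihedral_group n\<^esub> dihedral_r n [^]\<^bsub>dihedral_group n\<^esub> k = \<one>\<^bsub>dihedral_group n\<^esub>"
      then have "monomial_mat ?m (\<lambda>a. block_root [n] (block_swap [n] a) ^ k) (block_swap [n]) = 1\<^sub>m ?m"
        using \<rho>(3)[of k] \<rho>_one by simp
      then have "block_swap [n] 0 = 0"
        by (rule monomial_mat_eq_one) simp
      then show False by (simp add: block_swap_def)
    qed
  qed (use assms dihedral_relations dihedral_normal_form in auto)
qed

lemma faithful_hull_spectrum_exists:
  assumes n: "n > 0" and J: "\<forall>j\<in>J. j > 0" "Lcm J = n"
  shows "roots_hull 2 \<union> (\<Union>j\<in>J. roots_hull j) \<in> faithful_hull_spectra (dihedral_group n)"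
proof -
  interpret dihedral "dihedral_group n" n "dihedral_r n" "dihedral_s n"
    by (rule dihedral_dihedral_group[OF n])
  \<comment> \<open>An infinite set of naturals has \<open>Lcm\<close> equal to 0.\<close>
  have "finite J"
    using J(2) n Lcm_nat_infinite[of J] by auto
  \<comment> \<open>Adding 1 keeps \<open>js\<close> nonempty for \<open>J = {}\<close>, which
    occurs when \<open>n = 1\<close>. It changes neither the \<open>Lcm\<close> nor the final union,
    as \<open>roots_hull 1\<close> lies in \<open>roots_hull 2\<close>.\<close>
  then obtain js where js: "set js = insert 1 J"
    using finite_list[of "insert 1 J"] by auto
  have js_dvd: "\<forall>j\<in>set js. j > 0 \<and> j dvd n"
    using J dvd_Lcm[of _ J] by (auto simp: js)
  have js_ne: "js \<noteq> []" using js by auto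
  define m where "m = 2 * length js"
  obtain \<rho> where \<rho>: "\<rho> \<in> hom (dihedral_group n) (GL m)"
    "\<And>k. \<rho> (dihedral_r n [^]\<^bsub>dihedral_group n\<^esub> k) = monomial_mat m (\<lambda>a. block_root js a ^ k) (\<lambda>a. a)"
    "\<And>k. \<rho> (dihedral_s n \<otimes>\<^bsub>dihedral_group n\<^esub> dihedral_r n [^]\<^bsub>dihedral_group n\<^esub> k)
      = monomial_mat m (\<lambda>a. block_root js (block_swap js a) ^ k) (block_swap js)"
    using block_rep[OF js_dvd] unfolding m_def by blast
  have root: "primitive_root (js ! a) (block_root js a)" if "a < length js" for a
    using that js_dvd primitive_root_cis[of "js ! a"] by (simp add: block_root_def)
  \<comment> \<open>If a power of \<open>r\<close> acts trivially, every \<open>j\<close> in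
    \<open>js\<close> divides its exponent, hence so does \<open>n\<close>; a reflection moves the
    index 0 to the other half.\<close>
  have inj: "inj_on \<rho> (carrier (dihedral_group n))"
    unfolding inj_on_one_iff'[OF \<rho>(1) is_group group_GL]
  proof (intro allI impI)
    fix g assume g: "g \<in> carrier (dihedral_group n)" "\<rho> g = \<one>\<^bsub>GL m\<^esub>"
    obtain k :: nat where "g = dihedral_r n [^]\<^bsub>dihedral_group n\<^esub> k \<or>
        g = dihedral_s n \<otimes>\<^bsub>dihedral_group n\<^esub> dihedral_r n [^]\<^bsub>dihedral_group n\<^esub> k"
      using normal_form[OF g(1)] by blast
    then show "g = \<one>\<^bsub>dihedral_group n\<^esub>"
    proof
      assume g_eq: "g = dihedral_r n [^]\<^bsub>dihedral_group n\<^esub> k"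
      then have one: "monomial_mat m (\<lambda>a. block_root js a ^ k) (\<lambda>a. a) = 1\<^sub>m m"
        using \<rho>(2)[of k] g(2) by (simp add: GL_simps)
      have "j dvd k" if j: "j \<in> set js" for j
      proof -
        obtain a where a: "a < length js" "js ! a = j"
          using j by (auto simp: in_set_conv_nth)
        have "block_root js a ^ k = 1"
          using a by (intro monomial_mat_eq_one(2)[OF one]) (simp add: m_def)
        then show ?thesis
          using root[OF a(1)] a(2) by (simp add: primitive_root_def)
      qed
      then have "n dvd k"
        using J(2) js by (auto intro: Lcm_least)
      then show ?thesis
        unfolding g_eq by (rule r_pow_dvd)
    next
      assume "g = dihedral_s n \<otimes>\<^bsub>dihedral_group n\<^esub> dihedral_r n [^]\<^bsub>dihedral_group n\<^esub> k"
      then have "monomial_mat m (\<lambda>a. block_root js (block_swap js a) ^ k) (block_swap js) = 1\<^sub>m m"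
        using \<rho>(3)[of k] g(2) by (simp add: GL_simps)
      then have "block_swap js 0 = 0"
        by (rule monomial_mat_eq_one) (simp add: m_def js_ne)
      then show ?thesis
        using js_ne by (simp add: block_swap_def)
    qed
  qed
  interpret rep: dihedral_rep "dihedral_group n" n "dihedral_r n" "dihedral_s n" "fin_funs m"
    "\<lambda>g. mat_op m (\<rho> g)"
    by (rule dihedral_rep_mat_op[OF \<rho>(1) inj])
  have \<rho>_r: "mat_op m (\<rho> (dihedral_r n)) f = (\<lambda>a. if a < m then block_root js a * f a else 0)"
    if "f \<in> fin_funs m" for f
    using \<rho>(2)[of 1] that by (simp add: mat_op_diagonal)
  have "rep.orders = set js"
  proof (intro subset_antisym subsetI)
    fix j assume "j \<in> rep.orders"
    then obtain \<mu> f where \<mu>: "primitive_root j \<mu>" and f: "f \<in> fin_funs m" "f \<noteq> (\<lambda>x. 0)"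
      "mat_op m (\<rho> (dihedral_r n)) f = (\<lambda>x. \<mu> * f x)"
      by (auto simp: rep.orders_def)
    \<comment> \<open>At a nonzero coordinate of the eigenvector, the eigenvalue must equal the
      diagonal entry.\<close>
    obtain a where a: "f a \<noteq> 0" using f(2) by auto
    with f(1) have "a < m" by (rule fin_funs_nonzero_less)
    then have "block_root js a = \<mu>"
      using fun_cong[OF f(3), of a] f(1) a by (simp add: \<rho>_r)
    moreover obtain i where "i \<in> set js" "primitive_root i (block_root js a)"
      using primitive_block_root[of a js] \<open>a < m\<close> js_dvd unfolding m_def by blast
    ultimately show "j \<in> set js"
      using \<mu> primitive_root_unique by blast
  next
    fix j assume "j \<in> set js"
    then obtain a where a: "a < length js" "js ! a = j"
      by (auto simp: in_set_conv_nth)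
    \<comment> \<open>The unit vector at \<open>a\<close> is an eigenvector whose eigenvalue has
      order \<open>js ! a\<close>.\<close>
    define f where "f b = (if b = a then 1 else 0 :: complex)" for b
    have f: "f \<in> fin_funs m" "f \<noteq> (\<lambda>x. 0)"
      using a by (auto simp: fin_funs_def f_def m_def fun_eq_iff)
    have "mat_op m (\<rho> (dihedral_r n)) f = (\<lambda>x. block_root js a * f x)"
      unfolding \<rho>_r[OF f(1)] using a by (auto simp: f_def m_def)
    then show "j \<in> rep.orders"
      using root[OF a(1)] a(2) f unfolding rep.orders_def by blast
  qed
  then have "hull_spectrum m (\<rho> ` carrier (dihedral_group n)) = roots_hull 2 \<union> (\<Union>j\<in>insert 1 J. roots_hull j)"
    unfolding hull_spectrum_eq_op_hull_spectrum[OF finite_carrier] rep.op_hull_spectrum_eq js by simp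
  also have "\<dots> = roots_hull 2 \<union> (\<Union>j\<in>J. roots_hull j)"
    using roots_hull_1_subset by auto
  finally show ?thesis
    using \<rho>(1) inj unfolding faithful_hull_spectra_def by blast
qed

theorem corollary5p4:
  fixes n :: nat
  assumes "n > 0"
  shows "faithful_hull_spectra (dihedral_group n) =
           {roots_hull 2 \<union> (\<Union>j\<in>J. roots_hull j) | J :: nat set. (\<forall>j\<in>J. j > 0) \<and> Lcm J = n}
       \<and> maximal_hull_spectrum (dihedral_group n) = roots_hull 2 \<union> roots_hull n"
proof -
  interpret dihedral "dihedral_group n" n "dihedral_r n" "dihedral_s n"
    by (rule dihedral_dihedral_group[OF assms])
  have "\<exists>J. X = roots_hull 2 \<union> (\<Union>j\<in>J. roots_hull j) \<and> (\<forall>j\<in>J. j > 0) \<and> Lcm J = n"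
    if "X \<in> faithful_hull_spectra (dihedral_group n)" for X
  proof -
    obtain m \<rho> where X: "X = hull_spectrum m (\<rho> ` carrier (dihedral_group n))"
      and \<rho>: "\<rho> \<in> hom (dihedral_group n) (GL m)" "inj_on \<rho> (carrier (dihedral_group n))"
      using \<open>X \<in> _\<close> unfolding faithful_hull_spectra_def by blast
    interpret rep: dihedral_rep "dihedral_group n" n "dihedral_r n" "dihedral_s n" "fin_funs m"
      "\<lambda>g. mat_op m (\<rho> g)"
      by (rule dihedral_rep_mat_op[OF \<rho>])
    \<comment> \<open>The witness for \<open>J\<close> is the set of orders of the eigenvalues of
      \<open>\<rho> (dihedral_r n)\<close>.\<close>
    have "X = roots_hull 2 \<union> (\<Union>j\<in>rep.orders. roots_hull j)"
      unfolding X hull_spectrum_eq_op_hull_spectrum[OF finite_carrier] by (rule rep.op_hull_spectrum_eq)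
    moreover have "\<forall>j\<in>rep.orders. j > 0"
      by (auto simp: rep.orders_def primitive_root_def)
    ultimately show ?thesis
      using rep.Lcm_orders by blast
  qed
  then show ?thesis
    using faithful_hull_spectrum_exists[OF assms] maximal_hull_spectrum_eq by auto
qed

end
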